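(* Let $(G,X)$ be a topological dynamical system where $X$ is a finite-dimensional compact metric space. Let $r\in\mathbb{N}$. Suppose that for every $N\in\mathbb{N}$ it holds that $$\dim (G,X)_N < \frac{rN}{2}, \quad\text{where } (G,X)_N := \{x\in X : |G\cdot x|\le N\} \text{ and } G\cdot x=\{gx : g\in G\}.$$ Then a generic continuous function $f:X\to[0,1]^r$ induces a $G$-equivariant topological embedding $f^G:X\to([0,1]^r)^G$; that is, the set of $f\in C(X,[0,1]^r)$ for which $f^G$ is a $G$-equivariant topological embedding is comeagre in $C(X,[0,1]^r)$.
   Context: $\mathbb{N}=\{1,2,\dots\}$. A topological dynamical system $(G,X)$ consists of an arbitrary group $G$ (with the discrete topology) acting on a compact metric space $X$ so that the action map $G\times X\to X$, $(g,x)\mapsto gx$, is continuous (i.e. $G$ acts by homeomorphisms). $\dim$ denotes Lebesgue covering dimension. $C(X,[0,1]^r)$ is the space of continuous functions $X\to[0,1]^r$ with the topology of uniform convergence. A property is called generic if it holds on a comeagre subset of $C(X,[0,1]^r)$. The group $G$ acts on $([0,1]^r)^G$ (product topology) by the shift: $(g y)_h=y_{hg}$ for $y\in([0,1]^r)^G$ and $g,h\in G$. For continuous $f:X\to[0,1]^r$, the orbit map $f^G:X\to([0,1]^r)^G$ is given by $f^G(x)=(f(gx))_{g\in G}$. A map $\varphi$ between $G$-spaces is $G$-equivariant if $\varphi(gx)=g\varphi(x)$ for all $g\in G$ and all $x$. *)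

theory Defs
  imports "HOL-Analysis.Analysis" "HOL-Algebra.Group_Action"
begin

definition cover_refinement_of_order_le :: "'a topology \<Rightarrow> 'a set set \<Rightarrow> nat \<Rightarrow> bool"
  where "cover_refinement_of_order_le X \<U> m \<longleftrightarrow>
    (\<exists>\<V>. finite \<V> \<and> (\<forall>V\<in>\<V>. openin X V) \<and> \<Union>\<V> = topspace X \<and>
         (\<forall>V\<in>\<V>. \<exists>U\<in>\<U>. V \<subseteq> U) \<and>
         (\<forall>x\<in>topspace X. card {V \<in> \<V>. x \<in> V} \<le> m))"

text \<open>
  Lebesgue covering dimension, by finite open covers. In terms of the maximal number \<open>m\<close> of
  members of a refinement that share a point, the dimension is at most \<open>m - 1\<close>; the value \<open>m = 0\<close>
  is possible only for the empty space, whose dimension is therefore \<open>-1\<close>. If no bound exists,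
  the infimum is taken over the empty set and equals \<open>\<infinity>\<close>.
\<close>
definition covering_dim :: "'a topology \<Rightarrow> ereal"
  where "covering_dim X =
    Inf {ereal (real m - 1) |m.
      \<forall>\<U>. finite \<U> \<and> (\<forall>U\<in>\<U>. openin X U) \<and> \<Union>\<U> = topspace X
          \<longrightarrow> cover_refinement_of_order_le X \<U> m}"

definition nowhere_dense_in :: "'a topology \<Rightarrow> 'a set \<Rightarrow> bool"
  where "nowhere_dense_in X S \<longleftrightarrow> S \<subseteq> topspace X \<and> X interior_of (X closure_of S) = {}"

definition meagre_in :: "'a topology \<Rightarrow> 'a set \<Rightarrow> bool"
  where "meagre_in X S \<longleftrightarrow> (\<exists>\<N>. countable \<N> \<and> (\<forall>N\<in>\<N>. nowhere_dense_in X N) \<and> S = \<Union>\<N>)"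

definition comeagre_in :: "'a topology \<Rightarrow> 'a set \<Rightarrow> bool"
  where "comeagre_in X S \<longleftrightarrow> S \<subseteq> topspace X \<and> meagre_in X (topspace X - S)"

locale topological_dynamical_system = group_action G X \<phi> + Metric_space X d
  for G :: "('g, 'm) monoid_scheme" (structure)
    and X :: "'x set" and \<phi> :: "'g \<Rightarrow> 'x \<Rightarrow> 'x" and d :: "'x \<Rightarrow> 'x \<Rightarrow> real" +
  assumes compact: "compact_space mtopology"
    and continuous_action:
      "continuous_map (prod_topology (discrete_topology (carrier G)) mtopology) mtopology
         (\<lambda>(g, x). \<phi> g x)"

text \<open>The set \<open>(G,X)\<^sub>N\<close>. Finiteness is explicit because \<open>card\<close> of an infinite set is \<open>0\<close>.\<close>
definition points_of_orbit_card_le ::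
    "('g, 'm) monoid_scheme \<Rightarrow> 'x set \<Rightarrow> ('g \<Rightarrow> 'x \<Rightarrow> 'x) \<Rightarrow> nat \<Rightarrow> 'x set"
  where "points_of_orbit_card_le G X \<phi> N =
    {x \<in> X. finite (orbit G \<phi> x) \<and> card (orbit G \<phi> x) \<le> N}"

text \<open>\<open>[0,1]\<^sup>r\<close> with \<open>r = CARD('r)\<close>.\<close>
definition unit_cube :: "(real ^ 'r::finite) set"
  where "unit_cube = cbox 0 1"

text \<open>
  \<open>C(X,[0,1]\<^sup>r)\<close> with the supremum metric; its elements are extensional, i.e. equal to
  \<open>undefined\<close> outside \<open>topspace X\<close>.
\<close>
definition cube_maps :: "'x topology \<Rightarrow> ('x \<Rightarrow> real ^ 'r::finite) metric"
  where "cube_maps X = cfunspace X (submetric euclidean_metric unit_cube)"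

definition cube_shift_space :: "('g, 'm) monoid_scheme \<Rightarrow> ('g \<Rightarrow> real ^ 'r::finite) topology"
  where "cube_shift_space G = product_topology (\<lambda>_. top_of_set unit_cube) (carrier G)"

definition cube_shift ::
    "('g, 'm) monoid_scheme \<Rightarrow> 'g \<Rightarrow> ('g \<Rightarrow> real ^ 'r::finite) \<Rightarrow> ('g \<Rightarrow> real ^ 'r)"
  where "cube_shift G g =
    (\<lambda>y \<in> topspace (cube_shift_space G). \<lambda>h \<in> carrier G. y (h \<otimes>\<^bsub>G\<^esub> g))"

definition orbit_map ::
    "('g, 'm) monoid_scheme \<Rightarrow> ('g \<Rightarrow> 'x \<Rightarrow> 'x) \<Rightarrow> ('x \<Rightarrow> 'b) \<Rightarrow> 'x \<Rightarrow> 'g \<Rightarrow> 'b"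
  where "orbit_map G \<phi> f x = (\<lambda>g \<in> carrier G. f (\<phi> g x))"

definition equivariant_map ::
    "('g, 'm) monoid_scheme \<Rightarrow> 'x set \<Rightarrow> ('g \<Rightarrow> 'x \<Rightarrow> 'x) \<Rightarrow> ('g \<Rightarrow> 'y \<Rightarrow> 'y) \<Rightarrow> ('x \<Rightarrow> 'y) \<Rightarrow> bool"
  where "equivariant_map G X \<phi> \<psi> F \<longleftrightarrow>
    (\<forall>g \<in> carrier G. \<forall>x \<in> X. F (\<phi> g x) = \<psi> g (F x))"

end

theory Submission
  imports Defs
begin

text \<open>
  By Baire category it suffices to cover the pairs \<open>x \<noteq> y\<close> by countably many compact sets \<open>K\<close> such that
  the maps \<open>f\<close> with \<open>f (g x) \<noteq> f (g y)\<close> for some \<open>g\<close> from a finite set \<open>S\<close>, for each \<open>(x, y) \<in> K\<close>, are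
  dense. View the pairs \<open>{g x, g y}\<close> with \<open>g \<in> S\<close> as edges of a graph, and choose \<open>S\<close> such that each edge
  has a private end, one that belongs to no other edge; then the differences \<open>f (g x) - f (g y)\<close> can
  be shifted independently by changing \<open>f\<close> near the private ends only. This gives \<open>r |S|\<close> degrees of
  freedom, while an approximation of \<open>f\<close> through the nerve of a fine cover makes the differences
  range over finitely many affine pieces of at most the dimension of \<open>K\<close>; so a small shift
  removes all zeros when \<open>r |S|\<close> exceeds that dimension. The approximation is well defined on sets
  where the coincidences among the points \<open>g x\<close>, \<open>g y\<close> do not change, and there are finitely many
  coincidence patterns.

  If \<open>x\<close> has exactly \<open>N\<close> orbit points, \<open>y\<close> at most \<open>N\<close>, and \<open>y\<close> is not in the orbit of \<open>x\<close>, take \<open>|S| = N\<close>; the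
  pairs form a set of dimension at most \<open>2 dim (G,X)\<^sub>N < r N\<close>. If \<open>y = h x\<close>, a minimal edge cover of the
  orbit has \<open>|S| \<ge> N / 2\<close>, and the pairs \<open>(x, h x)\<close> form a set of dimension at most
  \<open>dim (G,X)\<^sub>N < r N / 2\<close>. If the orbit of \<open>x\<close> is infinite, \<open>|S|\<close> can be made as large as necessary.
\<close>

subsection \<open>Covering order and general position\<close>

text \<open>Gaussian elimination removes one equation and one unknown at a time. The solution
  \<open>w\<close> serves below as a nonzero linear functional that kills prescribed
  directions.\<close>

lemma homogeneous_linear_system_nonzero_solution:
  fixes m :: "'t \<Rightarrow> 'd \<Rightarrow> real"
  assumes "finite T" "finite D" "card T < card D"
  shows "\<exists>w. (\<exists>i\<in>D. w i \<noteq> 0) \<and> (\<forall>t\<in>T. (\<Sum>i\<in>D. w i * m t i) = 0)"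
  using assms
proof (induction T arbitrary: D m rule: finite_induct)
  case empty
  then show ?case by (intro exI[of _ "\<lambda>_. 1"]) (auto simp: card_gt_0_iff)
next
  case (insert t T)
  show ?case
  proof (cases "\<forall>i\<in>D. m t i = 0")
    case True
    have "card T < card D" using insert.hyps insert.prems by simp
    from insert.IH[OF insert.prems(1) this, of m] obtain w
      where w: "\<exists>i\<in>D. w i \<noteq> 0" "\<forall>s\<in>T. (\<Sum>i\<in>D. w i * m s i) = 0" by blast
    then show ?thesis using True by (intro exI[of _ w]) auto
  next
    case False
    then obtain p where p: "p \<in> D" "m t p \<noteq> 0" by blast
    define D' where "D' = D - {p}"
    have D: "D = insert p D'" "p \<notin> D'" "finite D'"
      using p insert.prems by (auto simp: D'_def)
    have "card T < card D'" using insert.hyps insert.prems D by simp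
    \<comment> \<open>The unknown \<open>p\<close> is eliminated: from each equation
      \<open>s\<close>, equation \<open>t\<close> times \<open>m s p / m t p\<close> is
      subtracted.\<close>
    from insert.IH[OF D(3) this, of "\<lambda>s i. m s i - m t i * m s p / m t p"] obtain w
      where w: "\<exists>i\<in>D'. w i \<noteq> 0"
        "\<forall>s\<in>T. (\<Sum>i\<in>D'. w i * (m s i - m t i * m s p / m t p)) = 0" by blast
    define c where "c = - (\<Sum>i\<in>D'. w i * m t i) / m t p"
    define v where "v = w(p := c)"
    have sum_v: "(\<Sum>i\<in>D. v i * m s i) = c * m s p + (\<Sum>i\<in>D'. w i * m s i)" for s
    proof -
      have "(\<Sum>i\<in>D'. v i * m s i) = (\<Sum>i\<in>D'. w i * m s i)"
        by (rule sum.cong) (use D in \<open>auto simp: v_def\<close>)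
      then show ?thesis using D by (simp add: v_def)
    qed
    have "(\<Sum>i\<in>D. v i * m s i) = 0" if "s \<in> insert t T" for s
    proof (cases "s = t")
      case True
      then show ?thesis using p by (simp add: sum_v c_def)
    next
      case False
      then have "0 = (\<Sum>i\<in>D'. w i * (m s i - m t i * m s p / m t p))" using that w by simp
      also have "\<dots> = (\<Sum>i\<in>D'. w i * m s i) - (\<Sum>i\<in>D'. w i * m t i) * (m s p / m t p)"
        by (simp add: right_diff_distrib sum_subtractf sum_distrib_right sum_divide_distrib mult.assoc)
      finally show ?thesis by (simp add: sum_v c_def)
    qed
    moreover have "\<exists>i\<in>D. v i \<noteq> 0" using w D by (auto simp: v_def)
    ultimately show ?thesis by blast
  qed
qed

text \<open>Each proper affine subspace meets the moment curve \<open>(t, t\<^sup>2, t\<^sup>3, \<dots>)\<close> only finitely often.\<close>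

lemma ex_small_avoiding_affine_subspaces:
  fixes \<Q> :: "(('d \<Rightarrow> real) \<times> (nat \<Rightarrow> 'd \<Rightarrow> real)) set"
  assumes "finite \<Q>" "finite D" "n < card D" "\<epsilon> > 0"
  shows "\<exists>c. (\<forall>i\<in>D. \<bar>c i\<bar> \<le> \<epsilon>) \<and>
    (\<forall>(q, \<tau>)\<in>\<Q>. \<forall>s. \<exists>i\<in>D. c i + (q i + (\<Sum>j<n. s j * \<tau> j i)) \<noteq> 0)"
proof -
  obtain idx where idx: "bij_betw idx D {..<card D}"
    using assms(2) ex_bij_betw_finite_nat by (metis atLeast0LessThan)
  \<comment> \<open>Exponents start at 1: for \<open>0 < t < 1\<close> every coordinate is then at
    most \<open>t\<close>, and the constant term of the polynomial \<open>p\<close> below stays free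
    for the offset \<open>q\<close>.\<close>
  define curve :: "real \<Rightarrow> 'd \<Rightarrow> real" where "curve t i = t ^ Suc (idx i)" for t i
  define hits where "hits q \<tau> = {t. \<exists>s. \<forall>i\<in>D. curve t i + (q i + (\<Sum>j<n. s j * \<tau> j i)) = 0}"
    for q :: "'d \<Rightarrow> real" and \<tau> :: "nat \<Rightarrow> 'd \<Rightarrow> real"
  have fin: "finite (hits q \<tau>)" for q \<tau>
  proof -
    obtain w where w: "\<exists>i\<in>D. w i \<noteq> 0" "\<forall>j\<in>{..<n}. (\<Sum>i\<in>D. w i * \<tau> j i) = 0"
      using homogeneous_linear_system_nonzero_solution[of "{..<n}" D \<tau>] assms by auto
    then obtain i0 where i0: "i0 \<in> D" "w i0 \<noteq> 0" by blast
    \<comment> \<open>Applying \<open>w\<close> to the point of the curve, moved by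
      \<open>q\<close>, removes the parameters \<open>s\<close> and leaves a polynomial in
      \<open>t\<close>. It is nonzero because distinct coordinates have distinct exponents.\<close>
    define p where "p = (\<Sum>i\<in>D. monom (w i) (Suc (idx i))) + [:\<Sum>i\<in>D. w i * q i:]"
    have "coeff p (Suc (idx i0)) = (\<Sum>i\<in>D. if i = i0 then w i else 0)"
      using i0 unfolding p_def
      by (auto simp: coeff_sum intro!: sum.cong dest: inj_onD[OF bij_betw_imp_inj_on[OF idx]])
    then have "p \<noteq> 0" using i0 assms(2) by auto
    moreover have "hits q \<tau> \<subseteq> {t. poly p t = 0}"
    proof clarsimp
      fix t assume "t \<in> hits q \<tau>"
      then obtain s where s: "\<forall>i\<in>D. curve t i + (q i + (\<Sum>j<n. s j * \<tau> j i)) = 0"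
        unfolding hits_def by blast
      have "0 = (\<Sum>i\<in>D. w i * (curve t i + (q i + (\<Sum>j<n. s j * \<tau> j i))))" using s by simp
      also have "\<dots> = (\<Sum>i\<in>D. w i * curve t i) + (\<Sum>i\<in>D. w i * q i) +
          (\<Sum>i\<in>D. \<Sum>j<n. s j * (w i * \<tau> j i))"
        by (simp add: distrib_left sum.distrib sum_distrib_left algebra_simps)
      also have "(\<Sum>i\<in>D. \<Sum>j<n. s j * (w i * \<tau> j i)) = (\<Sum>j<n. s j * (\<Sum>i\<in>D. w i * \<tau> j i))"
        by (subst sum.swap) (simp add: sum_distrib_left)
      also have "\<dots> = 0" using w by simp
      finally show "poly p t = 0"
        by (simp add: p_def poly_sum poly_monom curve_def)
    qed
    ultimately show ?thesis using poly_roots_finite finite_subset by blast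
  qed
  have "finite (\<Union>(q, \<tau>)\<in>\<Q>. hits q \<tau>)" using fin assms(1) by auto
  moreover have "infinite {0<..<min 1 \<epsilon>}" using assms(4) by (intro infinite_Ioo) simp
  ultimately obtain t where t: "t \<in> {0<..<min 1 \<epsilon>}" "t \<notin> (\<Union>(q, \<tau>)\<in>\<Q>. hits q \<tau>)"
    by (meson finite_subset subsetI)
  have "\<bar>curve t i\<bar> \<le> \<epsilon>" for i
  proof -
    have "t ^ idx i \<le> 1" using t by (intro power_le_one) auto
    then have "t * t ^ idx i \<le> t * 1" using t by (intro mult_left_mono) auto
    also have "\<dots> \<le> \<epsilon>" using t by simp
    finally show ?thesis using t by (simp add: curve_def abs_mult)
  qed
  moreover have "\<forall>(q, \<tau>)\<in>\<Q>. \<forall>s. \<exists>i\<in>D. curve t i + (q i + (\<Sum>j<n. s j * \<tau> j i)) \<noteq> 0"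
    using t(2) unfolding hits_def by fast
  ultimately show ?thesis by blast
qed

section \<open>Dimension bounds as orders of refinements\<close>

text \<open>This is the condition under the infimum in \<open>covering_dim\<close>, so it expresses
  that the dimension is at most \<open>m - 1\<close>.\<close>

definition covering_order_le :: "'a topology \<Rightarrow> nat \<Rightarrow> bool"
  where "covering_order_le X m \<longleftrightarrow>
    (\<forall>\<U>. finite \<U> \<and> (\<forall>U\<in>\<U>. openin X U) \<and> \<Union>\<U> = topspace X
      \<longrightarrow> cover_refinement_of_order_le X \<U> m)"

lemma covering_order_of_covering_dim_less:
  assumes "covering_dim X < c"
  obtains m where "covering_order_le X m" "ereal (real m - 1) < c"
  using assms unfolding covering_dim_def covering_order_le_def Inf_less_iff by blast

text \<open>An open cover of \<open>A\<close> becomes one of \<open>X\<close> by enlarging its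
  members to open sets of \<open>X\<close> and adding the complement of \<open>A\<close>; a
  refinement of that cover is then traced on \<open>A\<close>.\<close>

lemma covering_order_le_closed_subspace:
  assumes "covering_order_le X m" "closedin X A"
  shows "covering_order_le (subtopology X A) m"
  unfolding covering_order_le_def
proof clarify
  fix \<U> assume \<U>: "finite \<U>" "\<forall>U\<in>\<U>. openin (subtopology X A) U" "\<Union>\<U> = topspace (subtopology X A)"
  have A: "A \<subseteq> topspace X" using assms(2) closedin_subset by auto
  obtain E where E: "\<And>U. U \<in> \<U> \<Longrightarrow> openin X (E U) \<and> U = E U \<inter> A"
    using \<U>(2) unfolding openin_subtopology by metis
  define \<U>' where "\<U>' = insert (topspace X - A) (E ` \<U>)"
  have "\<Union>\<U>' = topspace X"
  proof
    show "\<Union>\<U>' \<subseteq> topspace X" using E openin_subset by (fastforce simp: \<U>'_def)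
    have "A \<subseteq> \<Union>\<U>" using \<U>(3) A by auto
    also have "\<dots> \<subseteq> \<Union>(E ` \<U>)" using E by fastforce
    finally show "topspace X \<subseteq> \<Union>\<U>'" unfolding \<U>'_def by blast
  qed
  moreover have "finite \<U>'" "\<forall>U\<in>\<U>'. openin X U"
    using \<U> E assms(2) by (auto simp: \<U>'_def openin_closedin_eq)
  ultimately obtain \<V> where \<V>: "finite \<V>" "\<forall>V\<in>\<V>. openin X V" "\<Union>\<V> = topspace X"
    "\<forall>V\<in>\<V>. \<exists>U\<in>\<U>'. V \<subseteq> U" "\<forall>x\<in>topspace X. card {V \<in> \<V>. x \<in> V} \<le> m"
    using assms(1)[unfolded covering_order_le_def, rule_format, of \<U>']
    unfolding cover_refinement_of_order_le_def by auto
  \<comment> \<open>Only members that meet \<open>A\<close> are kept: they do not lie in the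
    complement of \<open>A\<close>, so each lies in some \<open>E U\<close>.\<close>
  define \<W> where "\<W> = (\<lambda>V. V \<inter> A) ` {V \<in> \<V>. V \<inter> A \<noteq> {}}"
  show "cover_refinement_of_order_le (subtopology X A) \<U> m"
    unfolding cover_refinement_of_order_le_def
  proof (intro exI[of _ \<W>] conjI ballI)
    show "finite \<W>" using \<V> by (simp add: \<W>_def)
    show "openin (subtopology X A) W" if "W \<in> \<W>" for W
      using that \<V>(2) by (auto simp: \<W>_def openin_subtopology)
    show "\<Union>\<W> = topspace (subtopology X A)"
    proof -
      have "\<Union>\<W> = \<Union>\<V> \<inter> A" unfolding \<W>_def by blast
      then show ?thesis using \<V>(3) by simp
    qed
    show "\<exists>U\<in>\<U>. W \<subseteq> U" if W: "W \<in> \<W>" for W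
    proof -
      obtain V where V: "V \<in> \<V>" "V \<inter> A \<noteq> {}" "W = V \<inter> A" using W by (auto simp: \<W>_def)
      then obtain U' where "U' \<in> \<U>'" "V \<subseteq> U'" using \<V>(4) by blast
      with V obtain U where "U \<in> \<U>" "V \<subseteq> E U" unfolding \<U>'_def by blast
      then show ?thesis using E V by blast
    qed
    show "card {W \<in> \<W>. x \<in> W} \<le> m" if x: "x \<in> topspace (subtopology X A)" for x
    proof -
      have "{W \<in> \<W>. x \<in> W} \<subseteq> (\<lambda>V. V \<inter> A) ` {V \<in> \<V>. x \<in> V}" by (auto simp: \<W>_def)
      then have "card {W \<in> \<W>. x \<in> W} \<le> card {V \<in> \<V>. x \<in> V}"
        using \<V>(1) by (intro surj_card_le) auto
      then show ?thesis using \<V>(5) x by fastforce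
    qed
  qed
qed

text \<open>Each member of a cover is empty or the whole space, so the cover refines itself. A
  one-point space later fills the place of the second variable when a pair is determined by its
  first point.\<close>

lemma covering_order_le_singleton:
  assumes "topspace X \<subseteq> {x}"
  shows "covering_order_le X 1"
  unfolding covering_order_le_def
proof clarify
  fix \<U> assume \<U>: "finite \<U>" "\<forall>U\<in>\<U>. openin X U" "\<Union>\<U> = topspace X"
  have "\<forall>U\<in>\<U>. U = {} \<or> U = topspace X" using \<U> assms by blast
  have "card {V \<in> \<U>. y \<in> V} \<le> 1" if "y \<in> topspace X" for y
  proof -
    have "{V \<in> \<U>. y \<in> V} \<subseteq> {topspace X}"
      using \<open>\<forall>U\<in>\<U>. U = {} \<or> U = topspace X\<close> by blast
    then show ?thesis using card_mono[of "{topspace X}"] by simp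
  qed
  then show "cover_refinement_of_order_le X \<U> 1"
    unfolding cover_refinement_of_order_le_def using \<U> by blast
qed

section \<open>Approximation through the nerve of a cover\<close>

text \<open>Complete regularity supplies bump functions that vanish outside a member of the cover.
  Compactness leaves finitely many of them; they are grouped by member and divided by their
  sum.\<close>

lemma partition_of_unity_subordinate:
  assumes "compact_space X" "Hausdorff_space X"
    and "finite \<V>" "\<forall>V\<in>\<V>. openin X V" "\<Union>\<V> = topspace X"
  obtains \<psi> :: "'a set \<Rightarrow> 'a \<Rightarrow> real"
  where "\<And>V. V \<in> \<V> \<Longrightarrow> continuous_map X euclideanreal (\<psi> V)"
    "\<And>V x. V \<in> \<V> \<Longrightarrow> x \<in> topspace X \<Longrightarrow> 0 \<le> \<psi> V x"
    "\<And>V x. V \<in> \<V> \<Longrightarrow> x \<in> topspace X \<Longrightarrow> \<psi> V x \<noteq> 0 \<Longrightarrow> x \<in> V"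
    "\<And>x. x \<in> topspace X \<Longrightarrow> (\<Sum>V\<in>\<V>. \<psi> V x) = 1"
proof -
  have creg: "completely_regular_space X"
    using assms(1,2) compact_Hausdorff_or_regular_imp_normal_space normal_imp_completely_regular_space
    by blast
  have "\<exists>V u. V \<in> \<V> \<and> x \<in> V \<and> continuous_map X euclideanreal u \<and>
     (\<forall>y\<in>topspace X. 0 \<le> u y) \<and> u x = 1 \<and> (\<forall>y\<in>topspace X - V. u y = 0)" if x: "x \<in> topspace X" for x
  proof -
    obtain V where V: "V \<in> \<V>" "x \<in> V" using x assms(5) by blast
    then have "closedin X (topspace X - V)" "x \<in> topspace X - (topspace X - V)" using assms(4) x by auto
    then obtain u where u: "continuous_map X (top_of_set {0..1::real}) u" "u x = 0"
      "u ` (topspace X - V) \<subseteq> {1}" using creg unfolding completely_regular_space_def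
      by (metis image_subset_iff_funcset)
    have r: "u \<in> topspace X \<rightarrow> {0..1}" using u(1) by (simp add: continuous_map_in_subtopology)
    have "continuous_map X euclideanreal u" using u(1) continuous_map_into_fulltopology by blast
    then have "continuous_map X euclideanreal (\<lambda>y. 1 - u y)" by (intro continuous_intros)
    moreover have "\<forall>y\<in>topspace X. 0 \<le> 1 - u y" using r by (auto simp: Pi_iff)
    ultimately show ?thesis using V u by (intro exI[of _ V] exI[of _ "\<lambda>y. 1 - u y"]) auto
  qed
  then obtain v u where vu: "\<And>x. x \<in> topspace X \<Longrightarrow> v x \<in> \<V> \<and> x \<in> v x \<and>
     continuous_map X euclideanreal (u x) \<and> (\<forall>y\<in>topspace X. 0 \<le> u x y) \<and> u x x = (1::real) \<and>
     (\<forall>y\<in>topspace X - v x. u x y = 0)" by metis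
  define N where "N x = {y \<in> topspace X. u x y \<in> {0<..}}" for x
  have "openin X (N x)" if "x \<in> topspace X" for x
    unfolding N_def using vu[OF that] by (intro openin_continuous_map_preimage[where Y = euclideanreal]) auto
  moreover have "x \<in> N x" if "x \<in> topspace X" for x using vu[OF that] that by (auto simp: N_def)
  ultimately have "\<exists>F. finite F \<and> F \<subseteq> N ` topspace X \<and> topspace X \<subseteq> \<Union>F"
    using assms(1)[unfolded compact_space_alt, rule_format, of "N ` topspace X"] by blast
  then obtain F where F: "finite F" "F \<subseteq> topspace X" "topspace X \<subseteq> (\<Union>x\<in>F. N x)"
    by (metis finite_subset_image)
  define \<eta> where "\<eta> V y = (\<Sum>x | x \<in> F \<and> v x = V. u x y)" for V y
  define s where "s y = (\<Sum>V\<in>\<V>. \<eta> V y)" for y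
  have cont: "continuous_map X euclideanreal (\<eta> V)" for V
    unfolding \<eta>_def using F vu by (intro continuous_map_sum) auto
  then have conts: "continuous_map X euclideanreal s"
    unfolding s_def using assms(3) by (intro continuous_map_sum) auto
  have nn: "0 \<le> \<eta> V y" if "y \<in> topspace X" for V y
    unfolding \<eta>_def using F vu that by (intro sum_nonneg) auto
  have pos: "s y > 0" if y: "y \<in> topspace X" for y
  proof -
    have "s y = (\<Sum>x\<in>F. u x y)" unfolding s_def \<eta>_def
      using F vu assms(3) by (intro sum.group) auto
    moreover obtain x where "x \<in> F" "u x y > 0" using F(3) y by (auto simp: N_def)
    ultimately show ?thesis using F vu y by (auto intro!: sum_pos2)
  qed
  show ?thesis
  proof (rule that[of "\<lambda>V y. \<eta> V y / s y"])
    show "continuous_map X euclideanreal (\<lambda>y. \<eta> V y / s y)" for V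
      using cont conts pos by (intro continuous_map_real_divide) (auto dest!: pos)
    show "0 \<le> \<eta> V x / s x" if "x \<in> topspace X" for V x
      using nn pos that by (simp add: less_imp_le)
    show "x \<in> V" if "V \<in> \<V>" "x \<in> topspace X" "\<eta> V x / s x \<noteq> 0" for V x
    proof (rule ccontr)
      assume "x \<notin> V"
      then have "\<eta> V x = 0" unfolding \<eta>_def using that(2) F vu by (intro sum.neutral) auto
      then show False using that by simp
    qed
    show "(\<Sum>V\<in>\<V>. \<eta> V x / s x) = 1" if "x \<in> topspace X" for x
      using pos[OF that] by (simp add: s_def flip: sum_divide_distrib)
  qed
qed

text \<open>\<open>h i\<close> interpolates the values of \<open>F i\<close> at sample points
  \<open>\<xi> V\<close> by a partition of unity. At a point in at most \<open>a\<close> members of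
  the cover, the vector of all \<open>h i\<close> is a convex combination of at most
  \<open>a\<close> sample vectors, so it lies in an affine piece with \<open>a - 1\<close>
  directions. Since \<open>h i\<close> depends on \<open>F i\<close> only through its samples, equal
  functions have equal approximations.\<close>

lemma finite_dimensional_approximation:
  fixes F :: "'i \<Rightarrow> 'a \<Rightarrow> real"
  assumes "compact_space X" "Hausdorff_space X" "covering_order_le X a"
    and "finite I" "\<forall>i\<in>I. continuous_map X euclideanreal (F i)" "\<epsilon> > 0"
  shows "\<exists>h \<Q>. (\<forall>i\<in>I. continuous_map X euclideanreal (h i)) \<and>
    (\<forall>i\<in>I. \<forall>x\<in>topspace X. \<bar>h i x - F i x\<bar> \<le> \<epsilon>) \<and>
    (\<forall>i\<in>I. \<forall>j\<in>I. (\<forall>x\<in>topspace X. F i x = F j x) \<longrightarrow> (\<forall>x\<in>topspace X. h i x = h j x)) \<and>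
    finite \<Q> \<and>
    (\<forall>x\<in>topspace X. \<exists>(q, \<tau>)\<in>\<Q>. \<exists>s. \<forall>i\<in>I. h i x = q i + (\<Sum>j<a - 1. s j * \<tau> j i))"
proof -
  define N where "N x = topspace X \<inter> (\<Inter>i\<in>I. {y \<in> topspace X. F i y \<in> ball (F i x) (\<epsilon>/2)})" for x
  have "openin X {y \<in> topspace X. F i y \<in> ball (F i x) (\<epsilon>/2)}" if "i \<in> I" for i x
    by (rule openin_continuous_map_preimage[OF assms(5)[rule_format, OF that]]) simp
  then have open_N: "openin X (N x)" for x
    unfolding N_def by (subst Int_commute, rule openin_INT[OF assms(4)])
  have "x \<in> N x" if "x \<in> topspace X" for x using that \<open>\<epsilon> > 0\<close> by (auto simp: N_def)
  then have "\<exists>F. finite F \<and> F \<subseteq> N ` topspace X \<and> topspace X \<subseteq> \<Union>F"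
    using assms(1)[unfolded compact_space_alt, rule_format, of "N ` topspace X"] open_N by blast
  then obtain \<U> where \<U>: "finite \<U>" "\<U> \<subseteq> N ` topspace X" "topspace X \<subseteq> \<Union>\<U>" by blast
  have "\<Union>\<U> = topspace X" using \<U>(2,3) by (auto simp: N_def)
  moreover have "\<forall>U\<in>\<U>. openin X U" using \<U>(2) open_N by blast
  ultimately obtain \<V> where \<V>: "finite \<V>" "\<forall>V\<in>\<V>. openin X V" "\<Union>\<V> = topspace X"
    "\<forall>V\<in>\<V>. \<exists>U\<in>\<U>. V \<subseteq> U" "\<forall>x\<in>topspace X. card {V \<in> \<V>. x \<in> V} \<le> a"
    using assms(3)[unfolded covering_order_le_def, rule_format, of \<U>] \<U>(1)
    unfolding cover_refinement_of_order_le_def by auto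
  obtain \<psi> :: "'a set \<Rightarrow> 'a \<Rightarrow> real" where
    cont: "\<And>V. V \<in> \<V> \<Longrightarrow> continuous_map X euclideanreal (\<psi> V)" and
    nonneg: "\<And>V x. V \<in> \<V> \<Longrightarrow> x \<in> topspace X \<Longrightarrow> 0 \<le> \<psi> V x" and
    supp: "\<And>V x. V \<in> \<V> \<Longrightarrow> x \<in> topspace X \<Longrightarrow> \<psi> V x \<noteq> 0 \<Longrightarrow> x \<in> V" and
    one: "\<And>x. x \<in> topspace X \<Longrightarrow> (\<Sum>V\<in>\<V>. \<psi> V x) = 1"
    using partition_of_unity_subordinate[OF assms(1,2) \<V>(1-3)] by blast
  define \<xi> :: "'a set \<Rightarrow> 'a" where "\<xi> V = (SOME x. x \<in> V)" for V
  have \<xi>: "\<xi> V \<in> V" if "x \<in> V" for V x using that unfolding \<xi>_def by (rule someI)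
  have \<xi>X: "\<xi> V \<in> topspace X" if "x \<in> V" "V \<in> \<V>" for V x
    using \<xi>[OF that(1)] \<V>(3) that(2) by blast
  have osc: "\<bar>F i (\<xi> V) - F i x\<bar> \<le> \<epsilon>" if "i \<in> I" "V \<in> \<V>" "x \<in> V" for i V x
  proof -
    obtain z where "V \<subseteq> N z" using \<V>(4) \<U>(2) \<open>V \<in> \<V>\<close> by blast
    then have "x \<in> N z" "\<xi> V \<in> N z" using \<xi>[OF \<open>x \<in> V\<close>] \<open>x \<in> V\<close> by auto
    then have "dist (F i z) (F i x) < \<epsilon>/2" "dist (F i z) (F i (\<xi> V)) < \<epsilon>/2"
      using \<open>i \<in> I\<close> by (auto simp: N_def)
    then show ?thesis unfolding dist_real_def by linarith
  qed
  define h where "h i x = (\<Sum>V\<in>\<V>. \<psi> V x * F i (\<xi> V))" for i x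
  obtain en :: "'a set set \<Rightarrow> nat \<Rightarrow> 'a set"
    where en: "\<And>W. W \<subseteq> \<V> \<Longrightarrow> bij_betw (en W) {..<card W} W"
    using ex_bij_betw_nat_finite \<V>(1) finite_subset by (metis atLeast0LessThan)
  \<comment> \<open>The affine hull of the sample vectors of \<open>W\<close>: the first vector is
    the base point, and the differences from it are the directions. Zero directions pad the list, so
    that all pieces have the same number of parameters.\<close>
  define cell where "cell W = (\<lambda>i. F i (\<xi> (en W 0)),
      \<lambda>j i. if Suc j < card W then F i (\<xi> (en W (Suc j))) - F i (\<xi> (en W 0)) else 0)" for W
  have cells: "\<exists>(q, \<tau>)\<in>cell ` Pow \<V>. \<exists>s. \<forall>i\<in>I. h i x = q i + (\<Sum>j<a - 1. s j * \<tau> j i)"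
    if x: "x \<in> topspace X" for x
  proof -
    define W where "W = {V \<in> \<V>. x \<in> V}"
    have W: "W \<subseteq> \<V>" "finite W" "W \<noteq> {}" using \<V>(1,3) x by (auto simp: W_def)
    then obtain n where n: "card W = Suc n" by (metis card_eq_0_iff not0_implies_Suc)
    have na: "n \<le> a - 1" using \<V>(5) x n by (fastforce simp: W_def)
    have reindex: "(\<Sum>V\<in>\<V>. \<psi> V x * u V) = (\<Sum>k<Suc n. \<psi> (en W k) x * u (en W k))" for u
    proof -
      have "(\<Sum>V\<in>\<V>. \<psi> V x * u V) = (\<Sum>V\<in>W. \<psi> V x * u V)"
        using \<V>(1) W supp x by (intro sum.mono_neutral_right) (auto simp: W_def)
      also have "\<dots> = (\<Sum>k<Suc n. \<psi> (en W k) x * u (en W k))"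
        using sum.reindex_bij_betw[OF en[OF W(1)], of "\<lambda>V. \<psi> V x * u V"] n by simp
      finally show ?thesis .
    qed
    have "h i x = fst (cell W) i + (\<Sum>j<a - 1. \<psi> (en W (Suc j)) x * snd (cell W) j i)" if "i \<in> I" for i
    proof -
      \<comment> \<open>The weights sum to 1, so the weight of the base point is expressed by the
        others; this saves one parameter.\<close>
      have "\<psi> (en W 0) x = 1 - (\<Sum>k<n. \<psi> (en W (Suc k)) x)"
        using one[OF x] reindex[of "\<lambda>_. 1"] by (simp add: sum.lessThan_Suc_shift del: sum.lessThan_Suc)
      moreover have "h i x = \<psi> (en W 0) x * F i (\<xi> (en W 0)) +
          (\<Sum>k<n. \<psi> (en W (Suc k)) x * F i (\<xi> (en W (Suc k))))"
        unfolding h_def reindex by (simp add: sum.lessThan_Suc_shift del: sum.lessThan_Suc)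
      ultimately have "h i x = F i (\<xi> (en W 0)) +
          (\<Sum>k<n. \<psi> (en W (Suc k)) x * (F i (\<xi> (en W (Suc k))) - F i (\<xi> (en W 0))))"
        by (simp add: left_diff_distrib right_diff_distrib sum_subtractf sum_distrib_right)
      also have "(\<Sum>k<n. \<psi> (en W (Suc k)) x * (F i (\<xi> (en W (Suc k))) - F i (\<xi> (en W 0)))) =
          (\<Sum>j<a - 1. \<psi> (en W (Suc j)) x * snd (cell W) j i)"
        using na n by (intro sum.mono_neutral_cong_left) (auto simp: cell_def)
      finally show ?thesis by (simp add: cell_def)
    qed
    then show ?thesis using W(1)
      by (intro bexI[of _ "cell W"]) (auto simp: case_prod_unfold intro!: exI[of _ "\<lambda>j. \<psi> (en W (Suc j)) x"])
  qed
  show ?thesis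
  proof (intro exI[of _ h] exI[of _ "cell ` Pow \<V>"] conjI ballI impI)
    show "continuous_map X euclideanreal (h i)" for i
      unfolding h_def using cont \<V>(1)
      by (intro continuous_map_sum continuous_map_real_mult) auto
    show "\<bar>h i x - F i x\<bar> \<le> \<epsilon>" if i: "i \<in> I" and x: "x \<in> topspace X" for i x
    proof -
      have "h i x - F i x = (\<Sum>V\<in>\<V>. \<psi> V x * (F i (\<xi> V) - F i x))"
        using one[OF x] by (simp add: h_def right_diff_distrib sum_subtractf flip: sum_distrib_right)
      also have "\<bar>\<dots>\<bar> \<le> (\<Sum>V\<in>\<V>. \<bar>\<psi> V x * (F i (\<xi> V) - F i x)\<bar>)" by (rule sum_abs)
      also have "\<dots> \<le> (\<Sum>V\<in>\<V>. \<psi> V x * \<epsilon>)"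
      proof (rule sum_mono)
        fix V assume V: "V \<in> \<V>"
        show "\<bar>\<psi> V x * (F i (\<xi> V) - F i x)\<bar> \<le> \<psi> V x * \<epsilon>"
        proof (cases "\<psi> V x = 0")
          case False
          then have "\<bar>F i (\<xi> V) - F i x\<bar> \<le> \<epsilon>" using osc i V supp x by blast
          then show ?thesis using nonneg[OF V x] by (auto simp: abs_mult intro!: mult_left_mono)
        qed simp
      qed
      also have "\<dots> = \<epsilon>" using one[OF x] by (simp flip: sum_distrib_right)
      finally show ?thesis .
    qed
    show "h i x = h j x" if "\<forall>x\<in>topspace X. F i x = F j x" "x \<in> topspace X" for i j x
      unfolding h_def
    proof (rule sum.cong)
      fix V assume V: "V \<in> \<V>"
      show "\<psi> V x * F i (\<xi> V) = \<psi> V x * F j (\<xi> V)"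
      proof (cases "\<psi> V x = 0")
        case False
        then have "\<xi> V \<in> topspace X" using supp V that(2) \<xi>X by blast
        then show ?thesis using that(1) by simp
      qed simp
    qed simp
  qed (use cells \<V>(1) in auto)
qed

subsection \<open>Separating perturbations\<close>

text \<open>By \<open>compat\<close> the prescribed values glue to one function \<open>F\<close> on
  \<open>Z\<close>, the union of the images of the \<open>C v\<close> under \<open>p v\<close>.
  These are finitely many compact sets, so \<open>Z\<close> is closed and \<open>F\<close> is
  continuous, and Tietze's theorem applies.\<close>

lemma Tietze_extension_pieces:
  fixes f :: "'a \<Rightarrow> real" and p :: "'v \<Rightarrow> 'a \<Rightarrow> 'a"
  assumes X: "compact_space X" "Hausdorff_space X" and "finite P"
    and C: "\<And>v. v \<in> P \<Longrightarrow> closedin X (C v)"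
    and p: "\<And>v. v \<in> P \<Longrightarrow> continuous_map X X (p v)"
    and H: "\<And>v. v \<in> P \<Longrightarrow> continuous_map (subtopology X (C v)) euclideanreal (H v)"
    and compat: "\<And>v w x y. v \<in> P \<Longrightarrow> w \<in> P \<Longrightarrow> x \<in> C v \<Longrightarrow> y \<in> C w \<Longrightarrow> p v x = p w y \<Longrightarrow> H v x = H w y"
    and f: "continuous_map X euclideanreal f"
    and close: "\<And>v x. v \<in> P \<Longrightarrow> x \<in> C v \<Longrightarrow> \<bar>H v x - f (p v x)\<bar> \<le> \<delta>" and "\<delta> \<ge> 0"
  obtains f' where "continuous_map X euclideanreal f'"
    "\<And>x. x \<in> topspace X \<Longrightarrow> \<bar>f' x - f x\<bar> \<le> \<delta>"
    "\<And>v x. v \<in> P \<Longrightarrow> x \<in> C v \<Longrightarrow> f' (p v x) = H v x"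
proof -
  define Z where "Z = (\<Union>v\<in>P. p v ` C v)"
  have "\<exists>h. \<forall>v\<in>P. \<forall>x\<in>C v. p v x = z \<longrightarrow> h = H v x" for z
  proof (cases "\<exists>v\<in>P. \<exists>x\<in>C v. p v x = z")
    case True
    then obtain v x where "v \<in> P" "x \<in> C v" "p v x = z" by blast
    then show ?thesis using compat by (intro exI[of _ "H v x"]) blast
  qed blast
  then obtain F where F: "\<And>z v x. v \<in> P \<Longrightarrow> x \<in> C v \<Longrightarrow> p v x = z \<Longrightarrow> F z = H v x" by metis
  have img: "closedin X (p v ` K)" if "v \<in> P" "closedin X K" for v K
    using that X p by (meson closedin_compact_space compactin_imp_closedin image_compactin)
  have Z: "closedin X Z" unfolding Z_def using assms(3) img C by (intro closedin_Union) auto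
  have "continuous_map (subtopology X Z) euclideanreal F"
    unfolding continuous_map_closedin
  proof (intro conjI allI impI)
    fix U :: "real set" assume "closedin euclideanreal U"
    then have K: "closedin X {x \<in> C v. H v x \<in> U}" if "v \<in> P" for v
    proof -
      have "closedin (subtopology X (C v)) {x \<in> topspace (subtopology X (C v)). H v x \<in> U}"
        using H[OF that] \<open>closedin euclideanreal U\<close> by (rule closedin_continuous_map_preimage)
      moreover have "topspace (subtopology X (C v)) = C v"
        using C[OF that] closedin_subset by auto
      ultimately show ?thesis using C[OF that] closedin_trans_full by metis
    qed
    \<comment> \<open>The preimage of a closed set under \<open>F\<close> is a finite union of
      images of compact sets, hence closed.\<close>
    have "{z \<in> topspace (subtopology X Z). F z \<in> U} = (\<Union>v\<in>P. p v ` {x \<in> C v. H v x \<in> U})"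
      using F closedin_subset[OF Z] by (auto simp: Z_def subset_eq)
    moreover have "closedin X (\<Union>v\<in>P. p v ` {x \<in> C v. H v x \<in> U})"
      using assms(3) img K by (intro closedin_Union) auto
    ultimately show "closedin (subtopology X Z) {z \<in> topspace (subtopology X Z). F z \<in> U}"
      using Z by (simp add: closedin_closed_subtopology) blast
  qed auto
  \<comment> \<open>Extending \<open>F - f\<close> instead of \<open>F\<close> carries the bound
    \<delta> over to all of \<open>X\<close>.\<close>
  then have "continuous_map (subtopology X Z) euclideanreal (\<lambda>z. F z - f z)"
    using f by (intro continuous_map_diff) (auto simp: continuous_map_from_subtopology)
  moreover have "(\<lambda>z. F z - f z) ` Z \<subseteq> {-\<delta>..\<delta>}"
  proof
    fix t assume "t \<in> (\<lambda>z. F z - f z) ` Z"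
    then obtain v x where "v \<in> P" "x \<in> C v" "t = F (p v x) - f (p v x)" by (auto simp: Z_def)
    then show "t \<in> {-\<delta>..\<delta>}" using close[of v x] F[of v x] by auto
  qed
  moreover have "normal_space X"
    using X compact_Hausdorff_or_regular_imp_normal_space by blast
  ultimately obtain g where g: "continuous_map X euclideanreal g"
    "\<And>x. x \<in> Z \<Longrightarrow> g x = F x - f x" "g ` topspace X \<subseteq> {-\<delta>..\<delta>}"
    using Tietze_extension_closed_real_interval[of X Z "\<lambda>z. F z - f z" "-\<delta>" \<delta>] Z \<open>\<delta> \<ge> 0\<close> by auto
  show ?thesis
  proof (rule that[of "\<lambda>x. f x + g x"])
    show "continuous_map X euclideanreal (\<lambda>x. f x + g x)"
      using f g by (intro continuous_map_add)
    show "\<bar>f x + g x - f x\<bar> \<le> \<delta>" if "x \<in> topspace X" for x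
      using g(3) that by (auto simp: image_subset_iff)
    show "f (p v x) + g (p v x) = H v x" if "v \<in> P" "x \<in> C v" for v x
    proof -
      have "p v x \<in> Z" using that by (auto simp: Z_def)
      then show ?thesis using g(2) F[OF that] by simp
    qed
  qed
qed

lemma continuous_map_vec_nth:
  fixes f :: "'a \<Rightarrow> real ^ 'r"
  assumes "continuous_map X euclidean f"
  shows "continuous_map X euclideanreal (\<lambda>x. f x $ i)"
proof -
  have "continuous_map euclidean euclideanreal (\<lambda>z :: real ^ 'r. z $ i)"
    by (simp add: continuous_on_component)
  from continuous_map_compose[OF assms this] show ?thesis by (simp add: o_def)
qed

lemma continuous_map_vec_lambda:
  fixes f :: "'r::finite \<Rightarrow> 'a \<Rightarrow> real"
  assumes "\<And>i. continuous_map X euclideanreal (f i)"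
  shows "continuous_map X euclidean (\<lambda>x. \<chi> i. f i x)"
  using assms by (auto simp: continuous_map_atin intro: vec_tendstoI)

lemma sum_lessThan_add:
  "(\<Sum>j<m + k. g j) = (\<Sum>j<m. g j) + (\<Sum>j<k. g (m + j))" for g :: "nat \<Rightarrow> real"
  by (induction k) (auto simp: algebra_simps)

text \<open>
  The maps \<open>p v\<close> play the role of the group elements: they act on \<open>x \<in> A\<close> or on \<open>y \<in> B\<close>, according
  to \<open>side v\<close>, and \<open>pattern\<close> says that two of them have disjoint images unless they coincide. An
  edge \<open>e\<close> stands for the difference of the values of \<open>f\<close> at its two ends. After replacing \<open>f\<close> by its
  finite-dimensional approximations on the pieces \<open>p v ` C v\<close>, the vectors of all differences lie
  in finitely many affine subspaces of dimension at most \<open>(a - 1) + (b - 1)\<close>. Adding a constant on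
  the private end \<open>l e\<close> of each edge shifts them by an arbitrary vector, hence away from \<open>0\<close>.
\<close>

lemma separating_perturbation:
  fixes f :: "'a \<Rightarrow> real ^ 'r::finite" and A B :: "'a set" and p :: "'v \<Rightarrow> 'a \<Rightarrow> 'a"
    and side :: "'v \<Rightarrow> bool" and l r :: "'e \<Rightarrow> 'v"
  defines "C \<equiv> \<lambda>v. if side v then A else B"
  assumes X: "compact_space X" "Hausdorff_space X" "closedin X A" "closedin X B"
    and dims: "covering_order_le (subtopology X A) a" "covering_order_le (subtopology X B) b"
      "(a - 1) + (b - 1) < CARD('r) * card S"
    and P: "finite P" "\<And>v. v \<in> P \<Longrightarrow> continuous_map X X (p v)"
    and pattern: "\<And>v w x y. v \<in> P \<Longrightarrow> w \<in> P \<Longrightarrow> x \<in> C v \<Longrightarrow> y \<in> C w \<Longrightarrow> p v x = p w y \<Longrightarrow>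
      side v = side w \<and> x = y \<and> (\<forall>z\<in>C v. p v z = p w z)"
    and S: "finite S" "l \<in> S \<rightarrow> P" "r \<in> S \<rightarrow> P" "inj_on l S" "\<And>e e'. e \<in> S \<Longrightarrow> e' \<in> S \<Longrightarrow> r e \<noteq> l e'"
    and priv: "\<And>e w x y. e \<in> S \<Longrightarrow> w \<in> P \<Longrightarrow> w \<noteq> l e \<Longrightarrow> x \<in> C (l e) \<Longrightarrow> y \<in> C w \<Longrightarrow> p (l e) x \<noteq> p w y"
    and f: "continuous_map X euclidean f" "f \<in> topspace X \<rightarrow> unit_cube" and "\<epsilon> > 0"
  obtains f' where "continuous_map X euclidean f'" "f' \<in> topspace X \<rightarrow> unit_cube"
    "\<And>x. x \<in> topspace X \<Longrightarrow> norm (f' x - f x) \<le> \<epsilon>"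
    "\<And>x y. x \<in> A \<Longrightarrow> y \<in> B \<Longrightarrow>
      \<exists>e\<in>S. f' (p (l e) (if side (l e) then x else y)) \<noteq> f' (p (r e) (if side (r e) then x else y))"
proof -
  have sub: "A \<subseteq> topspace X" "B \<subseteq> topspace X" using X(3,4) closedin_subset by auto
  have compact_Hausdorff: "compact_space (subtopology X K)" "Hausdorff_space (subtopology X K)"
    if "closedin X K" for K
    using that X(1,2) by (auto simp: closedin_compact_space compact_space_subtopology Hausdorff_space_subtopology)
  \<comment> \<open>Each coordinate moves by at most \<delta> in passing from \<open>f\<close> to
    \<open>f0\<close> and by at most \<delta> afterwards; the norm is bounded by the sum over all
    coordinates, hence the divisor \<open>2 * CARD('r)\<close>.\<close>
  define \<delta> where "\<delta> = min (1/2) (\<epsilon> / (2 * CARD('r)))"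
  have \<delta>: "\<delta> > 0" "\<delta> \<le> 1/2" "2 * \<delta> * CARD('r) \<le> \<epsilon>"
  proof -
    show "\<delta> > 0" "\<delta> \<le> 1/2" using \<open>\<epsilon> > 0\<close> by (auto simp: \<delta>_def)
    have "\<delta> \<le> \<epsilon> / (2 * CARD('r))" by (simp add: \<delta>_def)
    then show "2 * \<delta> * CARD('r) \<le> \<epsilon>" by (simp add: field_simps)
  qed
  have f01: "0 \<le> f x $ i" "f x $ i \<le> 1" if "x \<in> topspace X" for x i
    using f(2) that by (auto simp: unit_cube_def Pi_iff mem_box_cart)
  \<comment> \<open>The cube is shrunk towards its centre, so that a further change of \<delta> per
    coordinate does not leave it. Half of this \<delta> goes to the approximation and half to the
    shift \<open>c\<close>.\<close>
  define f0 where "f0 i x = (1 - 2 * \<delta>) * f x $ i + \<delta>" for i x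
  have f0_range: "\<delta> \<le> f0 i x" "f0 i x \<le> 1 - \<delta>" "\<bar>f0 i x - f x $ i\<bar> \<le> \<delta>" if "x \<in> topspace X" for i x
  proof -
    have "0 \<le> (1 - 2 * \<delta>) * f x $ i" using \<delta> f01[OF that] by simp
    then show "\<delta> \<le> f0 i x" by (simp add: f0_def)
    have "(1 - 2 * \<delta>) * f x $ i \<le> (1 - 2 * \<delta>) * 1"
      using \<delta> f01[OF that] by (intro mult_left_mono) auto
    then show "f0 i x \<le> 1 - \<delta>" by (simp add: f0_def)
    have "\<delta> * f x $ i \<le> \<delta> * 1" "0 \<le> \<delta> * f x $ i"
      using \<delta> f01[OF that] by (intro mult_left_mono, auto)
    then show "\<bar>f0 i x - f x $ i\<bar> \<le> \<delta>" by (simp add: f0_def algebra_simps abs_le_iff)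
  qed
  have f0_cont: "continuous_map X euclideanreal (f0 i)" for i
    unfolding f0_def using continuous_map_vec_nth[OF f(1)] by (intro continuous_intros) auto
  define F where "F = (\<lambda>(v, i) x. f0 i (p v x))"
  have F_cont: "continuous_map (subtopology X K) euclideanreal (F vi)" if "fst vi \<in> P" for vi K
    using continuous_map_compose[OF P(2)[OF that] f0_cont[of "snd vi"]]
    by (auto simp: F_def case_prod_unfold o_def intro: continuous_map_from_subtopology)
  \<comment> \<open>Functions of \<open>x\<close> in \<open>A\<close> and functions of
    \<open>y\<close> in \<open>B\<close> are approximated separately, so that the numbers of
    parameters add up.\<close>
  let ?PA = "{v \<in> P. side v} \<times> (UNIV :: 'r set)" and ?PB = "{v \<in> P. \<not> side v} \<times> (UNIV :: 'r set)"
  have fin_PA: "finite ?PA" and fin_PB: "finite ?PB" and \<delta>2: "\<delta>/2 > 0" using P(1) \<delta>(1) by auto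
  have F_contA: "\<forall>i\<in>?PA. continuous_map (subtopology X A) euclideanreal (F i)"
    using F_cont by auto
  have F_contB: "\<forall>i\<in>?PB. continuous_map (subtopology X B) euclideanreal (F i)"
    using F_cont by auto
  obtain hA \<A> where hA: "\<forall>i\<in>?PA. continuous_map (subtopology X A) euclideanreal (hA i)"
    "\<forall>i\<in>?PA. \<forall>x\<in>topspace (subtopology X A). \<bar>hA i x - F i x\<bar> \<le> \<delta>/2"
    "\<forall>i\<in>?PA. \<forall>j\<in>?PA. (\<forall>x\<in>topspace (subtopology X A). F i x = F j x) \<longrightarrow>
      (\<forall>x\<in>topspace (subtopology X A). hA i x = hA j x)"
    and \<A>: "finite \<A>"
    "\<forall>x\<in>topspace (subtopology X A).
      \<exists>(q, \<tau>)\<in>\<A>. \<exists>s. \<forall>i\<in>?PA. hA i x = q i + (\<Sum>j<a - 1. s j * \<tau> j i)"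
    using finite_dimensional_approximation[OF compact_Hausdorff[OF X(3)] dims(1) fin_PA F_contA \<delta>2]
    by (elim exE conjE) (rule that)
  obtain hB \<B> where hB: "\<forall>i\<in>?PB. continuous_map (subtopology X B) euclideanreal (hB i)"
    "\<forall>i\<in>?PB. \<forall>x\<in>topspace (subtopology X B). \<bar>hB i x - F i x\<bar> \<le> \<delta>/2"
    "\<forall>i\<in>?PB. \<forall>j\<in>?PB. (\<forall>x\<in>topspace (subtopology X B). F i x = F j x) \<longrightarrow>
      (\<forall>x\<in>topspace (subtopology X B). hB i x = hB j x)"
    and \<B>: "finite \<B>"
    "\<forall>x\<in>topspace (subtopology X B).
      \<exists>(q, \<tau>)\<in>\<B>. \<exists>s. \<forall>i\<in>?PB. hB i x = q i + (\<Sum>j<b - 1. s j * \<tau> j i)"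
    using finite_dimensional_approximation[OF compact_Hausdorff[OF X(4)] dims(2) fin_PB F_contB \<delta>2]
    by (elim exE conjE) (rule that)
  have top[simp]: "topspace (subtopology X A) = A" "topspace (subtopology X B) = B"
    using sub by auto
  define h where "h v i = (if side v then hA (v, i) else hB (v, i))" for v i
  define pick :: "('v \<times> 'r \<Rightarrow> real) \<Rightarrow> ('v \<times> 'r \<Rightarrow> real) \<Rightarrow> 'v \<Rightarrow> 'r \<Rightarrow> real"
    where "pick u w v i = (if side v then u (v, i) else w (v, i))" for u w v i
  define diff :: "('v \<times> 'r \<Rightarrow> real) \<Rightarrow> ('v \<times> 'r \<Rightarrow> real) \<Rightarrow> 'e \<times> 'r \<Rightarrow> real"
    where "diff u w = (\<lambda>(e, i). pick u w (l e) i - pick u w (r e) i)" for u w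
  \<comment> \<open>A piece for \<open>x\<close> and a piece for \<open>y\<close> combine to a piece
    for the edge differences: the first \<open>a - 1\<close> directions vary the \<open>A\<close>
    side alone, the remaining \<open>b - 1\<close> the \<open>B\<close> side alone.\<close>
  define cell where "cell = (\<lambda>((qA, \<tau>A :: nat \<Rightarrow> 'v \<times> 'r \<Rightarrow> real), (qB, \<tau>B :: nat \<Rightarrow> 'v \<times> 'r \<Rightarrow> real)).
      (diff qA qB, \<lambda>j. if j < a - 1 then diff (\<tau>A j) (\<lambda>_. 0) else diff (\<lambda>_. 0) (\<tau>B (j - (a - 1)))))"
  obtain c where c: "\<forall>i\<in>S \<times> (UNIV :: 'r set). \<bar>c i\<bar> \<le> \<delta>/2"
    "\<forall>(q, \<tau>)\<in>cell ` (\<A> \<times> \<B>). \<forall>s. \<exists>i\<in>S \<times> UNIV. c i + (q i + (\<Sum>j<(a - 1) + (b - 1). s j * \<tau> j i)) \<noteq> 0"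
    using ex_small_avoiding_affine_subspaces[of "cell ` (\<A> \<times> \<B>)" "S \<times> (UNIV :: 'r set)"
        "(a - 1) + (b - 1)" "\<delta>/2"] \<A>(1) \<B>(1) S(1) dims(3) \<delta>(1)
    by (auto simp: card_cartesian_product mult.commute)
  \<comment> \<open>The constants sit on private ends only, and no \<open>r e\<close> is one, so the
    difference along \<open>e\<close> is shifted by exactly \<open>c (e, i)\<close>.\<close>
  define H where "H v i x = h v i x + (if v \<in> l ` S then c (inv_into S l v, i) else 0)" for v i x
  have "\<exists>f'. continuous_map X euclideanreal f' \<and> (\<forall>x\<in>topspace X. \<bar>f' x - f0 i x\<bar> \<le> \<delta>) \<and>
    (\<forall>v\<in>P. \<forall>x\<in>C v. f' (p v x) = H v i x)" for i
  proof (rule Tietze_extension_pieces[of X P C p "\<lambda>v. H v i" "f0 i" \<delta>])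
    show "closedin X (C v)" for v using X by (simp add: C_def)
    have "continuous_map (subtopology X (C v)) euclideanreal (h v i)" if "v \<in> P" for v
      using that hA(1) hB(1) by (auto simp: C_def h_def)
    then show "continuous_map (subtopology X (C v)) euclideanreal (H v i)" if "v \<in> P" for v
      unfolding H_def using that by (intro continuous_map_add) auto
    show "H v i x = H w i y" if "v \<in> P" "w \<in> P" "x \<in> C v" "y \<in> C w" "p v x = p w y" for v w x y
    proof (cases "v = w")
      case True
      then show ?thesis using pattern[OF that] by simp
    next
      case False
      \<comment> \<open>A private end never meets the image of another label, so nothing is added to
        \<open>v\<close> or \<open>w\<close>, and the approximations agree because \<open>F\<close>
        does.\<close>
      have "v \<notin> l ` S" "w \<notin> l ` S" using priv that False by (metis (full_types) imageE)+
      moreover have "h v i x = h w i y"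
        using pattern[OF that] that sub hA(3)[rule_format, of "(v, i)" "(w, i)" x] hB(3)[rule_format, of "(v, i)" "(w, i)" x]
        by (auto simp: h_def C_def F_def split: if_splits)
      ultimately show ?thesis by (simp add: H_def)
    qed
    show "\<bar>H v i x - f0 i (p v x)\<bar> \<le> \<delta>" if "v \<in> P" "x \<in> C v" for v x
    proof -
      have "\<bar>h v i x - f0 i (p v x)\<bar> \<le> \<delta>/2"
        using that sub hA(2)[rule_format, of "(v, i)" x] hB(2)[rule_format, of "(v, i)" x] by (auto simp: h_def C_def F_def split: if_splits)
      moreover have "\<bar>if v \<in> l ` S then c (inv_into S l v, i) else 0\<bar> \<le> \<delta>/2"
        using c(1) inv_into_into[of v l S] \<delta>(1) by auto
      ultimately show ?thesis unfolding H_def by linarith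
    qed
  qed (use X P f0_cont \<delta> in auto)
  then obtain f1 where f1: "\<And>i. continuous_map X euclideanreal (f1 i)"
    "\<And>i x. x \<in> topspace X \<Longrightarrow> \<bar>f1 i x - f0 i x\<bar> \<le> \<delta>"
    "\<And>i v x. v \<in> P \<Longrightarrow> x \<in> C v \<Longrightarrow> f1 i (p v x) = H v i x" by metis
  show ?thesis
  proof (rule that[of "\<lambda>x. \<chi> i. f1 i x"])
    show "continuous_map X euclidean (\<lambda>x. \<chi> i. f1 i x)"
      using f1(1) by (rule continuous_map_vec_lambda)
    show "(\<lambda>x. \<chi> i. f1 i x) \<in> topspace X \<rightarrow> unit_cube"
    proof
      fix x assume x: "x \<in> topspace X"
      have "0 \<le> f1 i x \<and> f1 i x \<le> 1" for i
        using f1(2)[OF x, of i] f0_range[OF x, of i] by linarith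
      then show "(\<chi> i. f1 i x) \<in> unit_cube" by (simp add: unit_cube_def mem_box_cart)
    qed
    show "norm ((\<chi> i. f1 i x) - f x) \<le> \<epsilon>" if x: "x \<in> topspace X" for x
    proof -
      have "norm ((\<chi> i. f1 i x) - f x) \<le> (\<Sum>i\<in>UNIV. \<bar>((\<chi> i. f1 i x) - f x) $ i\<bar>)"
        by (rule norm_le_l1_cart)
      also have "\<dots> \<le> (\<Sum>i\<in>(UNIV::'r set). 2 * \<delta>)"
      proof (rule sum_mono)
        fix i
        show "\<bar>((\<chi> i. f1 i x) - f x) $ i\<bar> \<le> 2 * \<delta>"
          using f1(2)[OF x, of i] f0_range(3)[OF x, of i] by simp
      qed
      also have "\<dots> \<le> \<epsilon>" using \<delta>(3) by (simp add: mult.commute)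
      finally show ?thesis .
    qed
    fix x y assume xy: "x \<in> A" "y \<in> B"
    define pt where "pt v = (if side v then x else y)" for v
    obtain qA \<tau>A sA where A: "(qA, \<tau>A) \<in> \<A>" "\<forall>i\<in>?PA. hA i x = qA i + (\<Sum>j<a - 1. sA j * \<tau>A j i)"
      using bspec[OF \<A>(2)[unfolded top] xy(1)] by blast
    obtain qB \<tau>B sB where B: "(qB, \<tau>B) \<in> \<B>" "\<forall>i\<in>?PB. hB i y = qB i + (\<Sum>j<b - 1. sB j * \<tau>B j i)"
      using bspec[OF \<B>(2)[unfolded top] xy(2)] by blast
    have "(diff qA qB, \<lambda>j. if j < a - 1 then diff (\<tau>A j) (\<lambda>_. 0) else diff (\<lambda>_. 0) (\<tau>B (j - (a - 1))))
      \<in> cell ` (\<A> \<times> \<B>)" using A(1) B(1) by (force simp: cell_def)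
    \<comment> \<open>The parameters of the combined piece are those of \<open>x\<close> followed by
      those of \<open>y\<close>.\<close>
    from c(2)[THEN bspec, OF this] obtain e i where e: "e \<in> S" and
      ne: "c (e, i) + (diff qA qB (e, i) + (\<Sum>j<(a - 1) + (b - 1).
        (if j < a - 1 then sA j else sB (j - (a - 1))) *
        (if j < a - 1 then diff (\<tau>A j) (\<lambda>_. 0) else diff (\<lambda>_. 0) (\<tau>B (j - (a - 1)))) (e, i))) \<noteq> 0"
      unfolding prod.case by (elim allE[of _ "\<lambda>j. if j < a - 1 then sA j else sB (j - (a - 1))"]) auto
    have hv: "h v i (pt v) = pick qA qB v i + (\<Sum>j<a - 1. sA j * pick (\<tau>A j) (\<lambda>_. 0) v i) +
      (\<Sum>j<b - 1. sB j * pick (\<lambda>_. 0) (\<tau>B j) v i)" if "v \<in> P" for v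
      using that A(2) B(2) by (simp add: h_def pt_def pick_def)
    have lr: "l e \<in> P" "r e \<in> P" "r e \<notin> l ` S" using S e by auto
    have "H (l e) i (pt (l e)) - H (r e) i (pt (r e)) =
        c (e, i) + (h (l e) i (pt (l e)) - h (r e) i (pt (r e)))"
      using lr e S(4) by (simp add: H_def inv_into_f_f)
    also have "h (l e) i (pt (l e)) - h (r e) i (pt (r e)) =
        diff qA qB (e, i) + ((\<Sum>j<a - 1. sA j * diff (\<tau>A j) (\<lambda>_. 0) (e, i)) +
        (\<Sum>j<b - 1. sB j * diff (\<lambda>_. 0) (\<tau>B j) (e, i)))"
      using hv lr by (simp add: diff_def right_diff_distrib sum_subtractf)
    finally have "H (l e) i (pt (l e)) \<noteq> H (r e) i (pt (r e))"
      using ne by (simp add: sum_lessThan_add)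
    moreover have "pt v \<in> C v" for v using xy by (simp add: pt_def C_def)
    ultimately have "f1 i (p (l e) (pt (l e))) \<noteq> f1 i (p (r e) (pt (r e)))"
      using f1(3) lr by simp
    then show "\<exists>e\<in>S. (\<chi> i. f1 i (p (l e) (if side (l e) then x else y))) \<noteq>
        (\<chi> i. f1 i (p (r e) (if side (r e) then x else y)))"
      using e unfolding pt_def vec_eq_iff by (intro bexI[of _ e]) auto
  qed
qed

subsection \<open>Negligible sets of pairs\<close>

lemma nowhere_dense_in_subset:
  "nowhere_dense_in X T \<Longrightarrow> S \<subseteq> T \<Longrightarrow> nowhere_dense_in X S"
  using interior_of_mono[OF closure_of_mono[of S T X]] unfolding nowhere_dense_in_def by blast

lemma meagre_in_subset:
  assumes "meagre_in X T" "S \<subseteq> T"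
  shows "meagre_in X S"
proof -
  obtain \<N> where \<N>: "countable \<N>" "\<forall>N\<in>\<N>. nowhere_dense_in X N" "T = \<Union>\<N>"
    using assms(1) unfolding meagre_in_def by blast
  have "S = \<Union>((\<inter>) S ` \<N>)" using assms(2) \<N>(3) by blast
  then show ?thesis
    unfolding meagre_in_def using \<N>
    by (intro exI[of _ "(\<inter>) S ` \<N>"]) (auto intro: nowhere_dense_in_subset)
qed

lemma meagre_in_UN:
  assumes "countable I" "\<And>i. i \<in> I \<Longrightarrow> meagre_in X (S i)"
  shows "meagre_in X (\<Union>i\<in>I. S i)"
proof -
  have "\<exists>\<N>. countable \<N> \<and> (\<forall>N\<in>\<N>. nowhere_dense_in X N) \<and> S i = \<Union>\<N>" if "i \<in> I" for i
    using assms(2)[OF that] unfolding meagre_in_def by blast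
  then obtain \<N> where \<N>: "\<And>i. i \<in> I \<Longrightarrow> countable (\<N> i) \<and> (\<forall>N\<in>\<N> i. nowhere_dense_in X N) \<and> S i = \<Union>(\<N> i)"
    by metis
  show ?thesis
    unfolding meagre_in_def
  proof (intro exI[of _ "\<Union>i\<in>I. \<N> i"] conjI)
    show "countable (\<Union>i\<in>I. \<N> i)" using assms(1) \<N> by blast
    show "(\<Union>i\<in>I. S i) = \<Union>(\<Union>i\<in>I. \<N> i)" using \<N> by fastforce
  qed (use \<N> in blast)
qed

lemma meagre_in_Un: "meagre_in X S \<Longrightarrow> meagre_in X T \<Longrightarrow> meagre_in X (S \<union> T)"
  using meagre_in_UN[of "{S, T}" X "\<lambda>S. S"] by auto

text \<open>Total boundedness gives a finite net for each radius \<open>1 / Suc n\<close>; the balls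
  about the points of these nets form a countable base.\<close>

lemma (in Metric_space) compact_imp_second_countable:
  assumes "compact_space mtopology"
  shows "second_countable mtopology"
proof -
  have "mtotally_bounded M"
    using assms by (simp add: compact_space_eq_mcomplete_mtotally_bounded)
  then have "\<exists>K. finite K \<and> K \<subseteq> M \<and> M \<subseteq> (\<Union>x\<in>K. mball x (1 / real (Suc n)))" for n
    unfolding mtotally_bounded_def by simp
  then obtain K where K: "\<And>n. finite (K n) \<and> K n \<subseteq> M \<and> M \<subseteq> (\<Union>x\<in>K n. mball x (1 / real (Suc n)))"
    by metis
  define \<B> where "\<B> = (\<Union>n. (\<lambda>x. mball x (1 / real (Suc n))) ` K n)"
  have "\<exists>V\<in>\<B>. x \<in> V \<and> V \<subseteq> U" if U: "openin mtopology U" "x \<in> U" for U x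
  proof -
    obtain r where r: "r > 0" "mball x r \<subseteq> U" using U openin_mtopology by blast
    have x: "x \<in> M" using U openin_mtopology by blast
    obtain n where n: "1 / real (Suc n) < r / 2" using r(1) by (metis half_gt_zero nat_approx_posE)
    obtain y where y: "y \<in> K n" "x \<in> mball y (1 / real (Suc n))" using K x by blast
    have "mball y (1 / real (Suc n)) \<subseteq> mball x r"
    proof
      fix z assume z: "z \<in> mball y (1 / real (Suc n))"
      then have "d x z \<le> d y x + d y z" using y triangle'' commute x by (metis in_mball triangle)
      then show "z \<in> mball x r" using y z n x by auto
    qed
    then show ?thesis using y r by (auto simp: \<B>_def)
  qed
  moreover have "countable \<B>" unfolding \<B>_def using K by (auto intro: countable_finite)
  moreover have "\<forall>V\<in>\<B>. openin mtopology V" by (auto simp: \<B>_def)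
  ultimately show ?thesis unfolding second_countable_def by blast
qed

section \<open>Pairs that a generic map separates\<close>

context topological_dynamical_system
begin

sublocale group G
  using group_hom group_hom.axioms(1) by blast

lemma act_closed [simp]: "g \<in> carrier G \<Longrightarrow> x \<in> X \<Longrightarrow> \<phi> g x \<in> X"
  using element_image by blast

lemma act_continuous: "g \<in> carrier G \<Longrightarrow> continuous_map mtopology mtopology (\<phi> g)"
proof -
  assume g: "g \<in> carrier G"
  have "continuous_map mtopology (prod_topology (discrete_topology (carrier G)) mtopology) (\<lambda>x. (g, x))"
    using g by (auto simp: continuous_map_pairedI)
  from continuous_map_compose[OF this continuous_action] show ?thesis by (simp add: o_def)
qed

lemma act_inj: "g \<in> carrier G \<Longrightarrow> x \<in> X \<Longrightarrow> y \<in> X \<Longrightarrow> \<phi> g x = \<phi> g y \<Longrightarrow> x = y"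
  using inj_prop by (meson inj_onD)

lemma mspace_cube_maps:
  "mspace (cube_maps mtopology :: ('x \<Rightarrow> real ^ 'r::finite) metric) =
    {f. f \<in> X \<rightarrow> unit_cube \<and> f \<in> extensional X \<and> continuous_map mtopology euclidean f}"
proof -
  have "compactin mtopology (topspace mtopology)" using compact by (simp add: compact_space_def)
  from compactin_mspace_cfunspace[OF this] show ?thesis
    unfolding cube_maps_def
    by (auto simp del: mspace_cfunspace simp: mtopology_of_submetric continuous_map_in_subtopology image_subset_iff)
qed

lemma mdist_cube_maps_le:
  fixes f g :: "'x \<Rightarrow> real ^ 'r::finite"
  assumes "0 \<le> B" "\<And>x. x \<in> X \<Longrightarrow> norm (f x - g x) \<le> B"
  shows "mdist (cube_maps mtopology) f g \<le> B"
  unfolding cube_maps_def using assms by (intro mdist_cfunspace_le) (auto simp: dist_norm)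

lemma norm_le_mdist_cube_maps:
  fixes f g :: "'x \<Rightarrow> real ^ 'r::finite"
  assumes "f \<in> mspace (cube_maps mtopology)" "g \<in> mspace (cube_maps mtopology)" "x \<in> X"
  shows "norm (f x - g x) \<le> mdist (cube_maps mtopology) f g"
  using mdist_cfunspace_imp_mdist_le[OF assms(1,2)[unfolded cube_maps_def] order_refl] assms(3)
  by (simp add: cube_maps_def dist_norm)

text \<open>Density in \<open>cube_maps mtopology\<close>, but without extensionality, so that
  perturbations may be arbitrary outside \<open>X\<close>; the restriction to \<open>X\<close> is
  made once, in \<open>negligible_pairs_compact\<close>.\<close>

definition dense_for_maps :: "(('x \<Rightarrow> real ^ 'r::finite) \<Rightarrow> bool) \<Rightarrow> bool"
  where "dense_for_maps \<Phi> \<longleftrightarrow>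
    (\<forall>f \<epsilon>. continuous_map mtopology euclidean f \<and> f \<in> X \<rightarrow> unit_cube \<and> \<epsilon> > 0 \<longrightarrow>
      (\<exists>f'. continuous_map mtopology euclidean f' \<and> f' \<in> X \<rightarrow> unit_cube \<and>
        (\<forall>x\<in>X. norm (f' x - f x) \<le> \<epsilon>) \<and> \<Phi> f'))"

lemma dense_for_maps_mono:
  assumes "dense_for_maps \<Phi>" "\<And>f. \<Phi> f \<Longrightarrow> \<Psi> f"
  shows "dense_for_maps \<Psi>"
  using assms unfolding dense_for_maps_def by meson

text \<open>These are the maps whose orbit map takes the same value at both points of some pair in
  \<open>Q\<close>.\<close>

definition unseparated :: "('x \<times> 'x) set \<Rightarrow> ('x \<Rightarrow> real ^ 'r::finite) set"
  where "unseparated Q = {f \<in> mspace (cube_maps mtopology).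
    \<exists>(x, y)\<in>Q. \<forall>g\<in>carrier G. f (\<phi> g x) = f (\<phi> g y)}"

text \<open>The type argument carries the dimension of the cube, which \<open>Q\<close> does not
  determine.\<close>

abbreviation negligible_pairs :: "'r::finite itself \<Rightarrow> ('x \<times> 'x) set \<Rightarrow> bool"
  where "negligible_pairs (_ :: 'r itself) Q \<equiv>
    meagre_in (mtopology_of (cube_maps mtopology)) (unseparated Q :: ('x \<Rightarrow> real ^ 'r) set)"

lemma negligible_pairs_subset:
  assumes "negligible_pairs TYPE('r::finite) Q'" "Q \<subseteq> Q'"
  shows "negligible_pairs TYPE('r) Q"
  using assms(1) by (rule meagre_in_subset) (use assms(2) in \<open>auto simp: unseparated_def\<close>)

lemma negligible_pairs_UN:
  assumes "countable I" "\<And>i. i \<in> I \<Longrightarrow> negligible_pairs TYPE('r::finite) (Q i)"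
  shows "negligible_pairs TYPE('r) (\<Union>i\<in>I. Q i)"
proof -
  have "unseparated (\<Union>i\<in>I. Q i) = (\<Union>i\<in>I. unseparated (Q i) :: ('x \<Rightarrow> real ^ 'r) set)"
    by (auto simp: unseparated_def)
  then show ?thesis using meagre_in_UN[OF assms] by simp
qed

lemma negligible_pairs_Un:
  assumes "negligible_pairs TYPE('r::finite) Q" "negligible_pairs TYPE('r) Q'"
  shows "negligible_pairs TYPE('r) (Q \<union> Q')"
proof -
  have "unseparated (Q \<union> Q') = (unseparated Q \<union> unseparated Q' :: ('x \<Rightarrow> real ^ 'r) set)"
    by (auto simp: unseparated_def)
  then show ?thesis using meagre_in_Un[OF assms] by simp
qed

lemma negligible_pairs_converse:
  "negligible_pairs TYPE('r::finite) (Q\<inverse>) \<longleftrightarrow> negligible_pairs TYPE('r) Q"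
proof -
  have "unseparated (Q\<inverse>) \<subseteq> (unseparated Q :: ('x \<Rightarrow> real ^ 'r) set)" for Q
  proof
    fix f :: "'x \<Rightarrow> real ^ 'r" assume "f \<in> unseparated (Q\<inverse>)"
    then obtain x y where "f \<in> mspace (cube_maps mtopology)" "(y, x) \<in> Q"
      "\<forall>g\<in>carrier G. f (\<phi> g y) = f (\<phi> g x)" by (auto simp: unseparated_def)
    then show "f \<in> unseparated Q" unfolding unseparated_def by blast
  qed
  from this[of Q] this[of "Q\<inverse>"] show ?thesis by simp
qed

text \<open>By second countability, countably many products of basic open sets on which
  \<open>Q\<close> is negligible already cover \<open>Q\<close>. Hence it suffices to work near one
  pair.\<close>

lemma negligible_pairs_locally:
  assumes "Q \<subseteq> X \<times> X"
    and "\<And>x y. (x, y) \<in> Q \<Longrightarrow> \<exists>U V. openin mtopology U \<and> openin mtopology V \<and> x \<in> U \<and> y \<in> V \<and>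
      negligible_pairs TYPE('r::finite) (Q \<inter> U \<times> V)"
  shows "negligible_pairs TYPE('r) Q"
proof -
  from compact_imp_second_countable[OF compact] obtain \<B>
    where \<B>: "countable \<B>" "\<forall>V\<in>\<B>. openin mtopology V"
      "\<forall>U x. openin mtopology U \<and> x \<in> U \<longrightarrow> (\<exists>V\<in>\<B>. x \<in> V \<and> V \<subseteq> U)"
    unfolding second_countable_def by (elim exE conjE)
  define I where "I = {(U, V) \<in> \<B> \<times> \<B>. negligible_pairs TYPE('r) (Q \<inter> U \<times> V)}"
  have "negligible_pairs TYPE('r) (\<Union>(U, V)\<in>I. Q \<inter> U \<times> V)"
  proof (rule negligible_pairs_UN)
    show "countable I"
      by (rule countable_subset[of _ "\<B> \<times> \<B>"]) (use \<B>(1) in \<open>auto simp: I_def\<close>)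
  qed (auto simp: I_def)
  moreover have "Q \<subseteq> (\<Union>(U, V)\<in>I. Q \<inter> U \<times> V)"
  proof
    fix z assume z: "z \<in> Q"
    obtain x y where xy: "z = (x, y)" by force
    obtain U V where UV: "openin mtopology U" "openin mtopology V" "x \<in> U" "y \<in> V"
      "negligible_pairs TYPE('r) (Q \<inter> U \<times> V)" using assms(2) z xy by blast
    obtain U' where U': "U' \<in> \<B>" "x \<in> U'" "U' \<subseteq> U" using \<B>(3) UV(1,3) by blast
    obtain V' where V': "V' \<in> \<B>" "y \<in> V'" "V' \<subseteq> V" using \<B>(3) UV(2,4) by blast
    have "negligible_pairs TYPE('r) (Q \<inter> U' \<times> V')"
      using UV(5) by (rule negligible_pairs_subset) (use U' V' in auto)
    then show "z \<in> (\<Union>(U, V)\<in>I. Q \<inter> U \<times> V)" using U' V' z xy by (auto simp: I_def)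
  qed
  ultimately show ?thesis by (rule negligible_pairs_subset)
qed

text \<open>By compactness, a map that separates every pair of \<open>K\<close> through
  \<open>S\<close> does so with a uniform margin, so such maps form an open set \<open>W\<close>. It
  is dense by hypothesis, so its complement is closed and nowhere dense, and it contains the
  unseparated maps.\<close>

lemma negligible_pairs_compact:
  fixes K :: "('x \<times> 'x) set"
  assumes K: "compactin (prod_topology mtopology mtopology) K"
    and S: "finite S" "S \<subseteq> carrier G"
    and dense: "dense_for_maps (\<lambda>f :: 'x \<Rightarrow> real ^ 'r::finite. \<forall>(x, y)\<in>K. \<exists>g\<in>S. f (\<phi> g x) \<noteq> f (\<phi> g y))"
  shows "negligible_pairs TYPE('r) K"
proof -
  let ?m = "cube_maps mtopology :: ('x \<Rightarrow> real ^ 'r) metric"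
  interpret C: Metric_space "mspace ?m" "mdist ?m" by simp
  have KX: "x \<in> X \<and> y \<in> X" if "(x, y) \<in> K" for x y
    using compactin_subset_topspace[OF K] that by auto
  define W where "W = {f \<in> mspace ?m. \<forall>(x, y)\<in>K. \<exists>g\<in>S. f (\<phi> g x) \<noteq> f (\<phi> g y)}"
  have "openin C.mtopology W"
    unfolding C.openin_mtopology
  proof (intro conjI allI impI)
    show "W \<subseteq> mspace ?m" by (auto simp: W_def)
    fix f assume f: "f \<in> W"
    then have fm: "f \<in> mspace ?m" and fc: "continuous_map mtopology euclidean f"
      by (auto simp: W_def mspace_cube_maps)
    define u where "u = (\<lambda>(x, y). \<Sum>g\<in>S. norm (f (\<phi> g x) - f (\<phi> g y)))"
    have "continuous_map (prod_topology mtopology mtopology) euclideanreal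
        (\<lambda>z. \<Sum>g\<in>S. norm (f (\<phi> g (fst z)) - f (\<phi> g (snd z))))"
    proof (intro continuous_map_sum continuous_map_norm continuous_map_diff)
      fix g assume "g \<in> S"
      then have g: "continuous_map mtopology euclidean (\<lambda>x. f (\<phi> g x))"
        using S continuous_map_compose[OF act_continuous fc] by (auto simp: o_def)
      show "continuous_map (prod_topology mtopology mtopology) euclidean (\<lambda>z. f (\<phi> g (fst z)))"
        using continuous_map_compose[OF continuous_map_fst g] by (simp add: o_def)
      show "continuous_map (prod_topology mtopology mtopology) euclidean (\<lambda>z. f (\<phi> g (snd z)))"
        using continuous_map_compose[OF continuous_map_snd g] by (simp add: o_def)
    qed (use S in auto)
    then have "compact (u ` K)"
      using image_compactin[OF K] by (simp add: u_def case_prod_unfold flip: compactin_euclidean_iff)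
    moreover have u_pos: "u z > 0" if "z \<in> K" for z
    proof -
      obtain x y where z: "z = (x, y)" by force
      have "\<forall>(x, y)\<in>K. \<exists>g\<in>S. f (\<phi> g x) \<noteq> f (\<phi> g y)" using f by (simp add: W_def)
      from bspec[OF this that] obtain g where "g \<in> S" "f (\<phi> g x) \<noteq> f (\<phi> g y)"
        using z by auto
      then show ?thesis using S z by (auto simp: u_def intro!: sum_pos2)
    qed
    ultimately have "\<exists>\<delta>>0. \<forall>z\<in>K. \<delta> \<le> u z"
    proof (cases "K = {}")
      case False
      then obtain z where "z \<in> K" "\<forall>w\<in>K. u z \<le> u w"
        using compact_attains_inf[OF \<open>compact (u ` K)\<close>] by auto
      then show ?thesis using u_pos by blast
    qed (auto intro: exI[of _ 1])
    then obtain \<delta> where \<delta>: "\<delta> > 0" "\<And>z. z \<in> K \<Longrightarrow> \<delta> \<le> u z" by blast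
    \<comment> \<open>If a map within \<rho> of \<open>f\<close> fails to separate a pair, then
      \<open>u\<close> is at most \<open>2 * \<rho> * card S\<close> there, which is below its
      minimum. The summand 1 keeps the denominator positive for empty \<open>S\<close>.\<close>
    define \<rho> where "\<rho> = \<delta> / (2 * real (card S) + 1)"
    have \<rho>: "\<rho> > 0" "2 * \<rho> * card S < \<delta>"
      using \<delta>(1) by (auto simp: \<rho>_def field_simps intro!: divide_pos_pos add_nonneg_pos)
    have "C.mball f \<rho> \<subseteq> W"
    proof
      fix f' assume "f' \<in> C.mball f \<rho>"
      then have f': "f' \<in> mspace ?m" "mdist ?m f f' < \<rho>" by auto
      have close: "norm (f x - f' x) < \<rho>" if "x \<in> X" for x
        using norm_le_mdist_cube_maps[OF fm f'(1) that] f'(2) by simp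
      show "f' \<in> W"
      proof (rule ccontr)
        assume "f' \<notin> W"
        then obtain x y where xy: "(x, y) \<in> K" "\<forall>g\<in>S. f' (\<phi> g x) = f' (\<phi> g y)"
          using f'(1) by (auto simp: W_def)
        have "u (x, y) \<le> (\<Sum>g\<in>S. 2 * \<rho>)"
          unfolding u_def prod.case
        proof (rule sum_mono)
          fix g assume g: "g \<in> S"
          have "f (\<phi> g x) - f (\<phi> g y) = (f (\<phi> g x) - f' (\<phi> g x)) - (f (\<phi> g y) - f' (\<phi> g y))"
            using xy(2) g by simp
          also have "norm \<dots> \<le> norm (f (\<phi> g x) - f' (\<phi> g x)) + norm (f (\<phi> g y) - f' (\<phi> g y))"
            by (rule norm_triangle_ineq4)
          also have "\<dots> \<le> 2 * \<rho>"
            using close[of "\<phi> g x"] close[of "\<phi> g y"] KX[OF xy(1)] g S(2) by (auto simp: subset_eq)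
          finally show "norm (f (\<phi> g x) - f (\<phi> g y)) \<le> 2 * \<rho>" .
        qed
        then show False using \<rho>(2) \<delta>(2)[OF xy(1)] by (simp add: mult.commute)
      qed
    qed
    then show "\<exists>r>0. C.mball f r \<subseteq> W" using \<rho>(1) by blast
  qed
  then have closed: "closedin C.mtopology (mspace ?m - W)"
    by (metis C.topspace_mtopology closedin_diff closedin_topspace)
  have "C.mtopology interior_of (mspace ?m - W) = {}"
  proof (rule ccontr)
    assume "C.mtopology interior_of (mspace ?m - W) \<noteq> {}"
    then obtain f where "f \<in> C.mtopology interior_of (mspace ?m - W)" by blast
    then have f: "f \<in> C.mtopology interior_of (mspace ?m - W)" .
    have "openin C.mtopology (C.mtopology interior_of (mspace ?m - W))" by simp
    with f have "\<exists>r>0. C.mball f r \<subseteq> C.mtopology interior_of (mspace ?m - W)"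
      unfolding C.openin_mtopology by blast
    then obtain r where r: "r > 0" "C.mball f r \<subseteq> mspace ?m - W"
      using interior_of_subset[of C.mtopology "mspace ?m - W"] by blast
    have fm: "f \<in> mspace ?m"
      using f interior_of_subset_topspace[of C.mtopology] by auto
    obtain f' where f': "continuous_map mtopology euclidean f'" "f' \<in> X \<rightarrow> unit_cube"
      "\<forall>x\<in>X. norm (f' x - f x) \<le> r/2" "\<forall>(x, y)\<in>K. \<exists>g\<in>S. f' (\<phi> g x) \<noteq> f' (\<phi> g y)"
      using dense[unfolded dense_for_maps_def, rule_format, of f "r/2"] fm r(1)
      by (auto simp: mspace_cube_maps)
    define f'' where "f'' = restrict f' X"
    have "continuous_map mtopology euclidean f''"
      by (rule continuous_map_eq[OF f'(1)]) (simp add: f''_def)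
    then have f'': "f'' \<in> mspace ?m" using f'(2) by (auto simp: mspace_cube_maps f''_def)
    have "mdist ?m f f'' \<le> r/2"
      using f'(3) r(1) by (intro mdist_cube_maps_le) (auto simp: f''_def norm_minus_commute)
    then have "f'' \<in> C.mball f r" using fm f'' r(1) by simp
    moreover have "f'' \<in> W"
    proof -
      have "\<exists>g\<in>S. f'' (\<phi> g x) \<noteq> f'' (\<phi> g y)" if "(x, y) \<in> K" for x y
        using f'(4) that KX[OF that] S(2) by (fastforce simp: f''_def)
      then show ?thesis using f'' by (auto simp: W_def)
    qed
    ultimately show False using r(2) by blast
  qed
  then have "nowhere_dense_in C.mtopology (mspace ?m - W)"
    using closed by (simp add: nowhere_dense_in_def closure_of_closedin)
  then have "meagre_in C.mtopology (mspace ?m - W)"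
    unfolding meagre_in_def by (intro exI[of _ "{mspace ?m - W}"]) auto
  moreover have "unseparated K \<subseteq> mspace ?m - W"
    using S(2) by (fastforce simp: unseparated_def W_def)
  ultimately show ?thesis unfolding mtopology_of_def by (rule meagre_in_subset)
qed

subsection \<open>Strata of constant coincidence pattern\<close>

text \<open>Vertex labels of the graph whose edges join \<open>g x\<close> to \<open>g y\<close>.
  Distinct labels may denote the same point; these coincidences form the pattern.\<close>

definition vert :: "'x \<Rightarrow> 'x \<Rightarrow> bool \<times> 'g \<Rightarrow> 'x"
  where "vert x y v = \<phi> (snd v) (if fst v then x else y)"

text \<open>Over small balls each vertex moves by less than half the least distance between distinct
  vertices. The two vertices are taken at independent pairs because the whole images have to be
  disjoint.\<close>

lemma separated_neighbourhoods:
  assumes x0: "x0 \<in> X" and y0: "y0 \<in> X" and P: "finite P" "snd ` P \<subseteq> carrier G"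
  shows "\<exists>\<delta>>0. \<forall>v\<in>P. \<forall>w\<in>P. vert x0 y0 v \<noteq> vert x0 y0 w \<longrightarrow>
    (\<forall>x\<in>mcball x0 \<delta>. \<forall>y\<in>mcball y0 \<delta>. \<forall>x'\<in>mcball x0 \<delta>. \<forall>y'\<in>mcball y0 \<delta>. vert x y v \<noteq> vert x' y' w)"
proof -
  have cont: "\<exists>\<delta>>0. \<forall>x\<in>mcball c \<delta>. d (\<phi> g c) (\<phi> g x) < \<eta>" if "c \<in> X" "g \<in> carrier G" "\<eta> > 0" for c g \<eta>
  proof -
    have "openin mtopology {x \<in> topspace mtopology. \<phi> g x \<in> mball (\<phi> g c) \<eta>}"
      using act_continuous[OF that(2)] openin_mball by (rule openin_continuous_map_preimage)
    moreover have "c \<in> {x \<in> topspace mtopology. \<phi> g x \<in> mball (\<phi> g c) \<eta>}" using that by simp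
    ultimately obtain r where r: "r > 0" "mball c r \<subseteq> {x \<in> topspace mtopology. \<phi> g x \<in> mball (\<phi> g c) \<eta>}"
      unfolding openin_mtopology by blast
    moreover have "mcball c (r/2) \<subseteq> mball c r"
      using r(1) by (intro mcball_subset_mball_concentric) simp
    ultimately show ?thesis by (intro exI[of _ "r/2"]) auto
  qed
  have PX: "vert x y v \<in> X" if "v \<in> P" "x \<in> X" "y \<in> X" for v x y
    using that P(2) by (auto simp: vert_def)
  define R where "R = {(v, w) \<in> P \<times> P. vert x0 y0 v \<noteq> vert x0 y0 w}"
  \<comment> \<open>Half the least distance between distinct vertices; the inserted 1 covers the
    case that there are none.\<close>
  define \<eta> where "\<eta> = Min (insert 1 ((\<lambda>(v, w). d (vert x0 y0 v) (vert x0 y0 w) / 2) ` R))"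
  have finR: "finite R" using P(1) by (auto simp: R_def intro: finite_subset[of _ "P \<times> P"])
  have "\<eta> > 0"
    unfolding \<eta>_def using finR PX x0 y0 by (auto simp: R_def)
  have "\<exists>\<delta>>0. \<forall>x\<in>mcball x0 \<delta>. \<forall>y\<in>mcball y0 \<delta>. d (vert x0 y0 v) (vert x y v) < \<eta>" if v: "v \<in> P" for v
  proof -
    have "(if fst v then x0 else y0) \<in> X" "snd v \<in> carrier G" using x0 y0 P(2) v by auto
    from cont[OF this \<open>\<eta> > 0\<close>] obtain \<delta> where "\<delta> > 0" "\<forall>x\<in>mcball (if fst v then x0 else y0) \<delta>.
        d (\<phi> (snd v) (if fst v then x0 else y0)) (\<phi> (snd v) x) < \<eta>" by blast
    then show ?thesis unfolding vert_def by (cases "fst v") auto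
  qed
  then obtain D where D: "\<And>v. v \<in> P \<Longrightarrow> D v > 0"
    "\<And>v x y. v \<in> P \<Longrightarrow> x \<in> mcball x0 (D v) \<Longrightarrow> y \<in> mcball y0 (D v) \<Longrightarrow> d (vert x0 y0 v) (vert x y v) < \<eta>"
    by metis
  define \<delta> where "\<delta> = Min (insert 1 (D ` P))"
  have \<delta>: "\<delta> > 0" "\<And>v. v \<in> P \<Longrightarrow> \<delta> \<le> D v" unfolding \<delta>_def using P(1) D(1) by auto
  show ?thesis
  proof (intro exI[of _ \<delta>] conjI \<delta>(1) ballI impI)
    fix v w x y x' y'
    assume *: "v \<in> P" "w \<in> P" "vert x0 y0 v \<noteq> vert x0 y0 w"
      and xy: "x \<in> mcball x0 \<delta>" "y \<in> mcball y0 \<delta>" "x' \<in> mcball x0 \<delta>" "y' \<in> mcball y0 \<delta>"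
    have "d (vert x0 y0 v) (vert x y v) < \<eta>" "d (vert x0 y0 w) (vert x' y' w) < \<eta>"
      using D(2) \<delta>(2) * xy by (fastforce simp: mcball_def)+
    moreover have "(v, w) \<in> R" using * by (simp add: R_def)
    then have "\<eta> \<le> d (vert x0 y0 v) (vert x0 y0 w) / 2" unfolding \<eta>_def using finR by (intro Min_le) force+
    moreover have "d (vert x0 y0 v) (vert x0 y0 w) \<le> d (vert x0 y0 v) (vert x y v) + d (vert x0 y0 w) (vert x' y' w)"
      if "vert x y v = vert x' y' w"
      using triangle[of "vert x0 y0 v" "vert x y v" "vert x0 y0 w"] that commute PX x0 y0 xy * by (auto simp: mcball_def)
    ultimately show "vert x y v \<noteq> vert x' y' w" by fastforce
  qed
qed

text \<open>Coincidences that hold at \<open>c\<close> are required to persist, which is a closed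
  condition. That no new ones arise is ensured separately by a small \<delta>.\<close>

definition coincidence_set :: "'g set \<Rightarrow> 'x set \<Rightarrow> 'x \<Rightarrow> real \<Rightarrow> 'x set"
  where "coincidence_set T Y c \<delta> =
    {x \<in> Y \<inter> mcball c \<delta>. \<forall>g\<in>T. \<forall>h\<in>T. \<phi> g c = \<phi> h c \<longrightarrow> \<phi> g x = \<phi> h x}"

lemma closedin_coincidence_set:
  assumes "closedin mtopology Y" "T \<subseteq> carrier G"
  shows "closedin mtopology (coincidence_set T Y c \<delta>)"
proof -
  define Z where "Z = (\<lambda>(g, h). {x \<in> topspace mtopology. \<phi> g x = \<phi> h x}) ` {(g, h) \<in> T \<times> T. \<phi> g c = \<phi> h c}"
  have "closedin mtopology {x \<in> topspace mtopology. \<phi> g x = \<phi> h x}" if "g \<in> T" "h \<in> T" for g h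
    using that assms(2) act_continuous Hausdorff_space_mtopology by (intro closedin_continuous_maps_eq) auto
  then have "closedin mtopology (\<Inter>(insert (Y \<inter> mcball c \<delta>) Z))"
    using assms(1) closedin_mcball by (intro closedin_Inter) (auto simp: Z_def)
  moreover have "coincidence_set T Y c \<delta> = \<Inter>(insert (Y \<inter> mcball c \<delta>) Z)"
    by (auto simp: coincidence_set_def Z_def)
  ultimately show ?thesis by simp
qed

text \<open>Near the base pair distinct vertices stay distinct, and on the coincidence sets equal
  vertices stay equal. So the pattern at one pair yields the hypotheses of
  \<open>separating_perturbation\<close> on the whole of both sets.\<close>

lemma locally_separating_perturbation:
  fixes l r :: "'e \<Rightarrow> bool \<times> 'g"
  assumes Y: "closedin mtopology Y" "closedin mtopology Y'"
    and dims: "covering_order_le (subtopology mtopology Y) a" "covering_order_le (subtopology mtopology Y') b"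
      "(a - 1) + (b - 1) < CARD('r::finite) * card S"
    and base: "x0 \<in> Y" "y0 \<in> Y'"
    and P: "finite P" "snd ` P \<subseteq> carrier G"
    and same_side: "\<And>v w. v \<in> P \<Longrightarrow> w \<in> P \<Longrightarrow> vert x0 y0 v = vert x0 y0 w \<Longrightarrow> fst v = fst w"
    and S: "finite S" "l \<in> S \<rightarrow> P" "r \<in> S \<rightarrow> P" "inj_on l S" "\<And>e e'. e \<in> S \<Longrightarrow> e' \<in> S \<Longrightarrow> r e \<noteq> l e'"
    and priv: "\<And>e w. e \<in> S \<Longrightarrow> w \<in> P \<Longrightarrow> w \<noteq> l e \<Longrightarrow> vert x0 y0 (l e) \<noteq> vert x0 y0 w"
  shows "\<exists>\<delta>>0. dense_for_maps (\<lambda>f :: 'x \<Rightarrow> real ^ 'r.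
    \<forall>x\<in>coincidence_set {g. (True, g) \<in> P} Y x0 \<delta>. \<forall>y\<in>coincidence_set {g. (False, g) \<in> P} Y' y0 \<delta>.
      \<exists>e\<in>S. f (vert x y (l e)) \<noteq> f (vert x y (r e)))"
proof -
  have x0: "x0 \<in> X" and y0: "y0 \<in> X" using base Y closedin_subset by force+
  obtain \<delta> where \<delta>: "\<delta> > 0"
    "\<forall>v\<in>P. \<forall>w\<in>P. vert x0 y0 v \<noteq> vert x0 y0 w \<longrightarrow>
      (\<forall>x\<in>mcball x0 \<delta>. \<forall>y\<in>mcball y0 \<delta>. \<forall>x'\<in>mcball x0 \<delta>. \<forall>y'\<in>mcball y0 \<delta>. vert x y v \<noteq> vert x' y' w)"
    using separated_neighbourhoods[OF x0 y0 P] by (elim exE conjE)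
  define A where "A = coincidence_set {g. (True, g) \<in> P} Y x0 \<delta>"
  define B where "B = coincidence_set {g. (False, g) \<in> P} Y' y0 \<delta>"
  have PG: "\<And>s g. (s, g) \<in> P \<Longrightarrow> g \<in> carrier G" using P(2) by force
  have cl: "closedin mtopology A" "closedin mtopology B"
    unfolding A_def B_def using Y PG by (auto intro!: closedin_coincidence_set)
  have sub: "A \<subseteq> Y" "A \<subseteq> mcball x0 \<delta>" "B \<subseteq> Y'" "B \<subseteq> mcball y0 \<delta>"
    by (auto simp: A_def B_def coincidence_set_def)
  have dim_A: "covering_order_le (subtopology mtopology A) a"
    using covering_order_le_closed_subspace[OF dims(1), of A] sub(1) cl(1)
    by (simp add: subtopology_subtopology inf.absorb2 closedin_subset_topspace)
  have dim_B: "covering_order_le (subtopology mtopology B) b"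
    using covering_order_le_closed_subspace[OF dims(2), of B] sub(3) cl(2)
    by (simp add: subtopology_subtopology inf.absorb2 closedin_subset_topspace)
  define C where "C v = (if fst v then A else B)" for v :: "bool \<times> 'g"
  have centre: "x0 \<in> mcball x0 \<delta>" "y0 \<in> mcball y0 \<delta>" using x0 y0 \<delta>(1) by auto
  \<comment> \<open>A vertex depends on one point of its pair only; the other entry is filled with
    the centre.\<close>
  have distinct: "\<phi> (snd v) x \<noteq> \<phi> (snd w) y"
    if "v \<in> P" "w \<in> P" "vert x0 y0 v \<noteq> vert x0 y0 w" "x \<in> C v" "y \<in> C w" for v w x y
    using \<delta>(2)[rule_format, OF that(1-3), of "if fst v then x else x0" "if fst v then y0 else x"
        "if fst w then y else x0" "if fst w then y0 else y"] that(4,5) sub centre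
    by (auto simp: vert_def C_def subset_eq simp del: in_mcball split: if_splits)
  have pattern: "fst v = fst w \<and> x = y \<and> (\<forall>z\<in>C v. \<phi> (snd v) z = \<phi> (snd w) z)"
    if vw: "v \<in> P" "w \<in> P" "x \<in> C v" "y \<in> C w" "\<phi> (snd v) x = \<phi> (snd w) y" for v w x y
  proof -
    have eq: "vert x0 y0 v = vert x0 y0 w" using distinct vw by blast
    have side: "fst v = fst w" using same_side vw eq by blast
    have all: "\<phi> (snd v) z = \<phi> (snd w) z" if "z \<in> C v" for z
    proof (cases "fst v")
      case True
      then have "z \<in> A" "snd v \<in> {g. (True, g) \<in> P}" "snd w \<in> {g. (True, g) \<in> P}"
        "\<phi> (snd v) x0 = \<phi> (snd w) x0"
        using that eq side vw(1,2) by (auto simp: C_def vert_def, (metis prod.collapse)+)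
      then show ?thesis unfolding A_def coincidence_set_def by blast
    next
      case False
      then have "z \<in> B" "snd v \<in> {g. (False, g) \<in> P}" "snd w \<in> {g. (False, g) \<in> P}"
        "\<phi> (snd v) y0 = \<phi> (snd w) y0"
        using that eq side vw(1,2) by (auto simp: C_def vert_def, (metis prod.collapse)+)
      then show ?thesis unfolding B_def coincidence_set_def by blast
    qed
    \<comment> \<open>Since \<open>v\<close> and \<open>w\<close> act alike on \<open>C v\<close>,
      both sides become images under the same injective map.\<close>
    have "\<phi> (snd w) x = \<phi> (snd w) y" using all vw by metis
    moreover have "x \<in> X" "y \<in> X" using vw(3,4) sub by (auto simp: C_def mcball_def split: if_splits)
    ultimately have "x = y" using act_inj vw(2) PG by (metis prod.collapse)
    then show ?thesis using side all by blast
  qed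
  have sep: "\<exists>f'. continuous_map mtopology euclidean f' \<and> f' \<in> X \<rightarrow> unit_cube \<and>
        (\<forall>x\<in>X. norm (f' x - f x) \<le> \<epsilon>) \<and>
        (\<forall>x\<in>A. \<forall>y\<in>B. \<exists>e\<in>S. f' (vert x y (l e)) \<noteq> f' (vert x y (r e)))"
    if f: "continuous_map mtopology euclidean f" "f \<in> X \<rightarrow> unit_cube" "\<epsilon> > 0"
    for f :: "'x \<Rightarrow> real ^ 'r" and \<epsilon>
  proof (rule separating_perturbation[of mtopology A B a b S P "\<lambda>v. \<phi> (snd v)" fst l r f \<epsilon>])
    show "Hausdorff_space mtopology" by (rule Hausdorff_space_mtopology)
    show "continuous_map mtopology mtopology (\<phi> (snd v))" if "v \<in> P" for v
      using act_continuous P(2) that by blast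
    show "fst v = fst w \<and> x = y \<and> (\<forall>z\<in>if fst v then A else B. \<phi> (snd v) z = \<phi> (snd w) z)"
      if "v \<in> P" "w \<in> P" "x \<in> (if fst v then A else B)" "y \<in> (if fst w then A else B)"
        "\<phi> (snd v) x = \<phi> (snd w) y" for v w x y
      using pattern that unfolding C_def by blast
    show "\<phi> (snd (l e)) x \<noteq> \<phi> (snd w) y" if "e \<in> S" "w \<in> P" "w \<noteq> l e"
      "x \<in> (if fst (l e) then A else B)" "y \<in> (if fst w then A else B)" for e w x y
      using distinct[of "l e" w x y] priv[OF that(1-3)] that S(2) unfolding C_def by blast
    fix f' :: "'x \<Rightarrow> real ^ 'r"
    assume "continuous_map mtopology euclidean f'" "f' \<in> topspace mtopology \<rightarrow> unit_cube"
      "\<And>x. x \<in> topspace mtopology \<Longrightarrow> norm (f' x - f x) \<le> \<epsilon>"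
      "\<And>x y. x \<in> A \<Longrightarrow> y \<in> B \<Longrightarrow> \<exists>e\<in>S. f' (\<phi> (snd (l e)) (if fst (l e) then x else y)) \<noteq>
        f' (\<phi> (snd (r e)) (if fst (r e) then x else y))"
    then show ?thesis unfolding vert_def by (intro exI[of _ f']) auto
  qed (use compact cl dim_A dim_B dims(3) P(1) S f in auto)
  show ?thesis using \<delta>(1) sep unfolding A_def B_def dense_for_maps_def by (intro exI[of _ \<delta>]) blast
qed

text \<open>\<sigma> selects for each edge the end that coincides with no other vertex, not even
  with the opposite end of the same edge.\<close>

definition private_vertices :: "'g set \<Rightarrow> ('g \<Rightarrow> bool) \<Rightarrow> 'x \<Rightarrow> 'x \<Rightarrow> bool"
  where "private_vertices S \<sigma> x y \<longleftrightarrow>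
    (\<forall>g\<in>S. \<forall>w\<in>UNIV \<times> S. w \<noteq> (\<sigma> g, g) \<longrightarrow> vert x y (\<sigma> g, g) \<noteq> vert x y w)"

text \<open>Here \<open>x\<close> and \<open>y\<close> vary independently, which costs
  \<open>2 * (m - 1)\<close> parameters. The set splits into finitely many strata by the
  coincidences among the \<open>g x\<close> and among the \<open>g y\<close>; locally each stratum
  lies in a product of two compact coincidence sets.\<close>

lemma negligible_pairs_disjoint:
  assumes Y: "closedin mtopology Y" "covering_order_le (subtopology mtopology Y) m"
    and S: "finite S" "S \<subseteq> carrier G" and dim: "2 * (m - 1) < CARD('r::finite) * card S"
  shows "negligible_pairs TYPE('r)
    {(x, y) \<in> Y \<times> Y. private_vertices S \<sigma> x y \<and> (\<forall>g\<in>S. \<forall>h\<in>S. \<phi> g x \<noteq> \<phi> h y)}"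
proof -
  have YX: "Y \<subseteq> X" using Y(1) closedin_subset by fastforce
  define coin where "coin x = {(g, h) \<in> S \<times> S. \<phi> g x = \<phi> h x}" for x
  define Q where "Q = (\<lambda>(E, F). {(x, y) \<in> Y \<times> Y. private_vertices S \<sigma> x y \<and>
    (\<forall>g\<in>S. \<forall>h\<in>S. \<phi> g x \<noteq> \<phi> h y) \<and> coin x = E \<and> coin y = F})"
  have "negligible_pairs TYPE('r) (Q i)" for i
  proof (rule negligible_pairs_locally)
    show "Q i \<subseteq> X \<times> X" using YX by (auto simp: Q_def case_prod_unfold)
    fix x0 y0 assume xy0: "(x0, y0) \<in> Q i"
    then have x0: "x0 \<in> Y" and y0: "y0 \<in> Y" and priv: "private_vertices S \<sigma> x0 y0"
      and disj: "\<forall>g\<in>S. \<forall>h\<in>S. \<phi> g x0 \<noteq> \<phi> h y0"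
      by (auto simp: Q_def case_prod_unfold)
    have coins: "coin x = coin x0" "coin y = coin y0" if "(x, y) \<in> Q i" for x y
      using that xy0 by (auto simp: Q_def case_prod_unfold)
    let ?P = "(UNIV :: bool set) \<times> S"
    have same_side: "fst v = fst w" if "v \<in> ?P" "w \<in> ?P" "vert x0 y0 v = vert x0 y0 w" for v w
    proof (rule ccontr)
      assume "fst v \<noteq> fst w"
      then show False using that disj by (cases "fst v") (auto simp: vert_def, metis)
    qed
    have dim': "(m - 1) + (m - 1) < CARD('r) * card S" using dim by simp
    have "\<exists>\<delta>>0. dense_for_maps (\<lambda>f :: 'x \<Rightarrow> real ^ 'r.
      \<forall>x\<in>coincidence_set {g. (True, g) \<in> ?P} Y x0 \<delta>. \<forall>y\<in>coincidence_set {g. (False, g) \<in> ?P} Y y0 \<delta>.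
        \<exists>e\<in>S. f (vert x y (\<sigma> e, e)) \<noteq> f (vert x y (\<not> \<sigma> e, e)))"
    proof (rule locally_separating_perturbation[of Y Y m m S x0 y0 ?P "\<lambda>g. (\<sigma> g, g)" "\<lambda>g. (\<not> \<sigma> g, g)"])
      show "vert x0 y0 (\<sigma> e, e) \<noteq> vert x0 y0 w" if "e \<in> S" "w \<in> ?P" "w \<noteq> (\<sigma> e, e)" for e w
        using priv that unfolding private_vertices_def by blast
      show "fst v = fst w" if "v \<in> ?P" "w \<in> ?P" "vert x0 y0 v = vert x0 y0 w" for v w
        using same_side that by blast
    qed (use Y dim' x0 y0 S in \<open>auto intro: inj_onI\<close>)
    then obtain \<delta> where \<delta>: "\<delta> > 0" "dense_for_maps (\<lambda>f :: 'x \<Rightarrow> real ^ 'r.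
      \<forall>x\<in>coincidence_set S Y x0 \<delta>. \<forall>y\<in>coincidence_set S Y y0 \<delta>.
        \<exists>e\<in>S. f (vert x y (\<sigma> e, e)) \<noteq> f (vert x y (\<not> \<sigma> e, e)))"
      by auto
    define A where "A = coincidence_set S Y x0 \<delta>"
    define B where "B = coincidence_set S Y y0 \<delta>"
    have "closedin mtopology A" "closedin mtopology B"
      unfolding A_def B_def using Y(1) S(2) by (auto intro: closedin_coincidence_set)
    then have "compactin (prod_topology mtopology mtopology) (A \<times> B)"
      using compact by (auto simp: compactin_Times closedin_compact_space)
    then have "negligible_pairs TYPE('r) (A \<times> B)"
    proof (rule negligible_pairs_compact[OF _ S dense_for_maps_mono[OF \<delta>(2)]])
      fix f :: "'x \<Rightarrow> real ^ 'r"
      assume f: "\<forall>x\<in>coincidence_set S Y x0 \<delta>. \<forall>y\<in>coincidence_set S Y y0 \<delta>.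
        \<exists>e\<in>S. f (vert x y (\<sigma> e, e)) \<noteq> f (vert x y (\<not> \<sigma> e, e))"
      have "\<exists>g\<in>S. f (\<phi> g x) \<noteq> f (\<phi> g y)" if "x \<in> A" "y \<in> B" for x y
      proof -
        from bspec[OF bspec[OF f that(1)[unfolded A_def]] that(2)[unfolded B_def]]
        obtain e where "e \<in> S" "f (vert x y (\<sigma> e, e)) \<noteq> f (vert x y (\<not> \<sigma> e, e))" by blast
        then show ?thesis by (intro bexI[of _ e]) (auto simp: vert_def split: if_splits)
      qed
      then show "\<forall>(x, y)\<in>A \<times> B. \<exists>g\<in>S. f (\<phi> g x) \<noteq> f (\<phi> g y)" by blast
    qed
    \<comment> \<open>A pair in the stratum has the same coincidences as the base pair, so near it
      the stratum lies in \<open>A \<times> B\<close>.\<close>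
    moreover have "Q i \<inter> mball x0 \<delta> \<times> mball y0 \<delta> \<subseteq> A \<times> B"
    proof clarify
      fix x y assume xy: "(x, y) \<in> Q i" "x \<in> mball x0 \<delta>" "y \<in> mball y0 \<delta>"
      have "\<phi> g x = \<phi> h x" if "g \<in> S" "h \<in> S" "\<phi> g x0 = \<phi> h x0" for g h
        using coins(1)[OF xy(1)] that by (auto simp: coin_def)
      moreover have "\<phi> g y = \<phi> h y" if "g \<in> S" "h \<in> S" "\<phi> g y0 = \<phi> h y0" for g h
        using coins(2)[OF xy(1)] that by (auto simp: coin_def)
      moreover have "x \<in> Y" "y \<in> Y" using xy(1) by (auto simp: Q_def case_prod_unfold)
      moreover have "x \<in> mcball x0 \<delta>" "y \<in> mcball y0 \<delta>" using mball_subset_mcball xy by blast+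
      ultimately show "x \<in> A \<and> y \<in> B" unfolding A_def B_def coincidence_set_def by blast
    qed
    ultimately have "negligible_pairs TYPE('r) (Q i \<inter> mball x0 \<delta> \<times> mball y0 \<delta>)"
      by (rule negligible_pairs_subset)
    then show "\<exists>U V. openin mtopology U \<and> openin mtopology V \<and> x0 \<in> U \<and> y0 \<in> V \<and>
        negligible_pairs TYPE('r) (Q i \<inter> U \<times> V)"
      using x0 y0 YX \<delta>(1) by (intro exI[of _ "mball x0 \<delta>"] exI[of _ "mball y0 \<delta>"]) auto
  qed
  moreover have "countable (Pow (S \<times> S) \<times> Pow (S \<times> S))" using S(1) by (simp add: countable_finite)
  ultimately have "negligible_pairs TYPE('r) (\<Union>i\<in>Pow (S \<times> S) \<times> Pow (S \<times> S). Q i)"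
    by (intro negligible_pairs_UN) auto
  then show ?thesis
    by (rule negligible_pairs_subset) (auto simp: Q_def coin_def)
qed

text \<open>If \<open>y = k x\<close>, both ends of an edge are translates of the single point
  \<open>x\<close>, so only \<open>m - 1\<close> parameters occur. The second factor is the
  one-point set \<open>{x0}\<close> of order 1, which contributes none.\<close>

lemma negligible_pairs_graph:
  assumes Y: "closedin mtopology Y" "covering_order_le (subtopology mtopology Y) m"
    and S: "finite S" "S \<subseteq> carrier G" and k: "k \<in> carrier G" and dim: "m - 1 < CARD('r::finite) * card S"
  shows "negligible_pairs TYPE('r) ((\<lambda>x. (x, \<phi> k x)) ` {x \<in> Y. private_vertices S \<sigma> x (\<phi> k x)})"
proof -
  have YX: "Y \<subseteq> X" using Y(1) closedin_subset by fastforce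
  \<comment> \<open>The end \<open>g y\<close> is \<open>(g \<otimes> k) x\<close>, so every vertex
    is rewritten as a translate of \<open>x\<close>.\<close>
  define elt where "elt = (\<lambda>(s, g). if s then g else g \<otimes> k)"
  define T where "T = elt ` (UNIV \<times> S)"
  have elt_G: "elt (s, g) \<in> carrier G" if "g \<in> S" for s g using that S(2) k by (auto simp: elt_def)
  have T: "finite T" "T \<subseteq> carrier G" using S(1) elt_G by (auto simp: T_def)
  have vert_elt: "vert x (\<phi> k x) v = \<phi> (elt v) x" if "x \<in> X" "snd v \<in> S" for x v
    using that S(2) k composition_rule[of x "snd v" k] by (auto simp: vert_def elt_def case_prod_unfold)
  define coin where "coin x = {(g, h) \<in> T \<times> T. \<phi> g x = \<phi> h x}" for x
  define Q where "Q E = (\<lambda>x. (x, \<phi> k x)) ` {x \<in> Y. private_vertices S \<sigma> x (\<phi> k x) \<and> coin x = E}" for E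
  have "negligible_pairs TYPE('r) (Q E)" for E
  proof (rule negligible_pairs_locally)
    show "Q E \<subseteq> X \<times> X" using YX k by (auto simp: Q_def)
    fix x0 y0 assume xy0: "(x0, y0) \<in> Q E"
    then have x0: "x0 \<in> Y" and y0: "y0 = \<phi> k x0" and priv: "private_vertices S \<sigma> x0 (\<phi> k x0)"
      and E: "coin x0 = E"
      by (auto simp: Q_def)
    have x0X: "x0 \<in> X" using x0 YX by blast
    let ?l = "\<lambda>g. (True, elt (\<sigma> g, g))" and ?r = "\<lambda>g. (True, elt (\<not> \<sigma> g, g))"
    \<comment> \<open>All labels lie on the first side; a coincidence of an \<open>x\<close> end
      with a \<open>y\<close> end is thus an ordinary coincidence within \<open>T\<close>.\<close>
    let ?P = "{True} \<times> T"
    have priv_elt: "\<phi> (elt (\<sigma> g, g)) x0 \<noteq> \<phi> (elt w) x0" if "g \<in> S" "snd w \<in> S" "w \<noteq> (\<sigma> g, g)" for g w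
    proof -
      have "vert x0 (\<phi> k x0) (\<sigma> g, g) \<noteq> vert x0 (\<phi> k x0) w"
      proof -
        have "w \<in> UNIV \<times> S" using that(2) by (cases w) simp
        then show ?thesis using priv that unfolding private_vertices_def by blast
      qed
      then show ?thesis using vert_elt[OF x0X] that by simp
    qed
    have "\<exists>\<delta>>0. dense_for_maps (\<lambda>f :: 'x \<Rightarrow> real ^ 'r.
      \<forall>x\<in>coincidence_set {g. (True, g) \<in> ?P} Y x0 \<delta>. \<forall>y\<in>coincidence_set {g. (False, g) \<in> ?P} {x0} x0 \<delta>.
        \<exists>e\<in>S. f (vert x y (?l e)) \<noteq> f (vert x y (?r e)))"
    proof (rule locally_separating_perturbation[of Y "{x0}" m 1 S x0 x0 ?P ?l ?r])
      show "closedin mtopology {x0}"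
        using x0X Hausdorff_space_mtopology by (simp add: Hausdorff_imp_t1_space closedin_t1_singleton)
      show "covering_order_le (subtopology mtopology {x0}) 1"
        by (rule covering_order_le_singleton[of _ x0]) auto
      show "inj_on ?l S"
      proof (rule inj_onI)
        fix g h assume gh: "g \<in> S" "h \<in> S" "?l g = ?l h"
        then show "g = h" using priv_elt[of g "(\<sigma> h, h)"] by auto
      qed
      show "?r e \<noteq> ?l e'" if "e \<in> S" "e' \<in> S" for e e'
        using priv_elt[of e' "(\<not> \<sigma> e, e)"] that by (cases "e = e'") auto
      show "vert x0 x0 (?l e) \<noteq> vert x0 x0 w" if "e \<in> S" "w \<in> ?P" "w \<noteq> ?l e" for e w
      proof -
        obtain v where "snd v \<in> S" "w = (True, elt v)" using \<open>w \<in> ?P\<close> by (auto simp: T_def)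
        then show ?thesis using priv_elt[of e v] that by (auto simp: vert_def)
      qed
      show "snd ` ?P \<subseteq> carrier G" "?l \<in> S \<rightarrow> ?P" "?r \<in> S \<rightarrow> ?P"
        using T by (auto simp: T_def)
    qed (use Y dim x0 T(1) S(1) in auto)
    then obtain \<delta> where \<delta>: "\<delta> > 0" "dense_for_maps (\<lambda>f :: 'x \<Rightarrow> real ^ 'r.
      \<forall>x\<in>coincidence_set T Y x0 \<delta>. \<forall>y\<in>coincidence_set {} {x0} x0 \<delta>.
        \<exists>e\<in>S. f (vert x y (?l e)) \<noteq> f (vert x y (?r e)))"
      by auto
    define A where "A = coincidence_set T Y x0 \<delta>"
    define K where "K = (\<lambda>x. (x, \<phi> k x)) ` A"
    have "closedin mtopology A"
      unfolding A_def using Y(1) T(2) by (rule closedin_coincidence_set)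
    then have "compactin mtopology A" using compact by (simp add: closedin_compact_space)
    moreover have "continuous_map mtopology (prod_topology mtopology mtopology) (\<lambda>x. (x, \<phi> k x))"
      using act_continuous[OF k] by (simp add: continuous_map_pairedI)
    ultimately have "compactin (prod_topology mtopology mtopology) K"
      unfolding K_def by (rule image_compactin)
    then have "negligible_pairs TYPE('r) K"
    proof (rule negligible_pairs_compact[OF _ S dense_for_maps_mono[OF \<delta>(2)]])
      fix f :: "'x \<Rightarrow> real ^ 'r"
      assume f: "\<forall>x\<in>coincidence_set T Y x0 \<delta>. \<forall>y\<in>coincidence_set {} {x0} x0 \<delta>.
        \<exists>e\<in>S. f (vert x y (?l e)) \<noteq> f (vert x y (?r e))"
      have "\<exists>g\<in>S. f (\<phi> g x) \<noteq> f (\<phi> g (\<phi> k x))" if x: "x \<in> A" for x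
      proof -
        have "x \<in> X" using x YX by (auto simp: A_def coincidence_set_def)
        moreover have "x0 \<in> coincidence_set {} {x0} x0 \<delta>"
          using x0X \<delta>(1) by (auto simp: coincidence_set_def)
        from bspec[OF bspec[OF f x[unfolded A_def]] this]
        obtain e where "e \<in> S" "f (vert x x0 (?l e)) \<noteq> f (vert x x0 (?r e))" by blast
        ultimately show ?thesis
          using S(2) k composition_rule[of x e k]
          by (intro bexI[of _ e]) (auto simp: vert_def elt_def split: if_splits)
      qed
      then show "\<forall>(x, y)\<in>K. \<exists>g\<in>S. f (\<phi> g x) \<noteq> f (\<phi> g y)" by (auto simp: K_def)
    qed
    \<comment> \<open>The second factor is all of \<open>X\<close>, as \<open>y\<close> is
      determined by \<open>x\<close>.\<close>
    moreover have "Q E \<inter> mball x0 \<delta> \<times> X \<subseteq> K"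
    proof clarify
      fix x y assume xy: "(x, y) \<in> Q E" "x \<in> mball x0 \<delta>"
      have "coin x = coin x0" using xy E by (auto simp: Q_def)
      then have "\<phi> g x = \<phi> h x" if "g \<in> T" "h \<in> T" "\<phi> g x0 = \<phi> h x0" for g h
        using that by (auto simp: coin_def)
      moreover have "x \<in> Y" "y = \<phi> k x" using xy(1) by (auto simp: Q_def)
      moreover have "x \<in> mcball x0 \<delta>" using mball_subset_mcball xy by blast
      ultimately show "(x, y) \<in> K" unfolding A_def K_def coincidence_set_def by blast
    qed
    ultimately have "negligible_pairs TYPE('r) (Q E \<inter> mball x0 \<delta> \<times> X)"
      by (rule negligible_pairs_subset)
    then show "\<exists>U V. openin mtopology U \<and> openin mtopology V \<and> x0 \<in> U \<and> y0 \<in> V \<and>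
        negligible_pairs TYPE('r) (Q E \<inter> U \<times> V)"
      using x0X y0 k \<delta>(1) openin_topspace[of mtopology]
      by (intro exI[of _ "mball x0 \<delta>"] exI[of _ X]) auto
  qed
  moreover have "countable (Pow (T \<times> T))" using T(1) by (simp add: countable_finite)
  ultimately have "negligible_pairs TYPE('r) (\<Union>E\<in>Pow (T \<times> T). Q E)"
    by (intro negligible_pairs_UN) auto
  then show ?thesis
    by (rule negligible_pairs_subset) (auto simp: Q_def coin_def)
qed

subsection \<open>Orbits\<close>

lemma act_eq_imp:
  assumes "g \<in> carrier G" "h \<in> carrier G" "x \<in> X" "y \<in> X" "\<phi> g x = \<phi> h y"
  shows "y = \<phi> (inv h \<otimes> g) x"
  using assms orbit_sym_aux[of h y "\<phi> g x"] composition_rule[of x "inv h" g] by simp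

text \<open>
  If \<open>g x = h y\<close> for some \<open>g, h \<in> S\<close>, then the pair lies on the graph of \<open>h\<inverse>g\<close>, where only half the
  dimension bound is needed.
\<close>

lemma negligible_pairs_private:
  assumes Y: "closedin mtopology Y" "covering_order_le (subtopology mtopology Y) m"
    and S: "finite S" "S \<subseteq> carrier G" and dim: "2 * (m - 1) < CARD('r::finite) * card S"
  shows "negligible_pairs TYPE('r) {(x, y) \<in> Y \<times> Y. private_vertices S \<sigma> x y}"
proof -
  have YX: "Y \<subseteq> X" using Y(1) closedin_subset by fastforce
  define \<Gamma> where "\<Gamma> = (\<lambda>(g, h). (\<lambda>x. (x, \<phi> (inv h \<otimes> g) x)) `
    {x \<in> Y. private_vertices S \<sigma> x (\<phi> (inv h \<otimes> g) x)})"
  have graphs: "negligible_pairs TYPE('r) (\<Union>i\<in>S \<times> S. \<Gamma> i)"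
  proof (rule negligible_pairs_UN)
    show "countable (S \<times> S)" using S(1) by (simp add: countable_finite)
    show "negligible_pairs TYPE('r) (\<Gamma> i)" if "i \<in> S \<times> S" for i
      using that S(2) dim unfolding \<Gamma>_def
      by (cases i) (auto intro!: negligible_pairs_graph[OF Y S])
  qed
  have "{(x, y) \<in> Y \<times> Y. private_vertices S \<sigma> x y} \<subseteq>
    {(x, y) \<in> Y \<times> Y. private_vertices S \<sigma> x y \<and> (\<forall>g\<in>S. \<forall>h\<in>S. \<phi> g x \<noteq> \<phi> h y)} \<union> (\<Union>i\<in>S \<times> S. \<Gamma> i)"
    (is "_ \<subseteq> ?disjoint \<union> ?graphs")
  proof (rule subrelI, rule UnCI)
    fix x y assume "(x, y) \<in> {(x, y) \<in> Y \<times> Y. private_vertices S \<sigma> x y}" and xy4: "(x, y) \<notin> ?graphs"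
    then have xy: "x \<in> Y" "y \<in> Y" "private_vertices S \<sigma> x y" by auto
    have "\<phi> g x \<noteq> \<phi> h y" if gh: "g \<in> S" "h \<in> S" for g h
    proof
      assume eq: "\<phi> g x = \<phi> h y"
      have "y = \<phi> (inv h \<otimes> g) x" using act_eq_imp[OF _ _ _ _ eq] gh S(2) xy YX by blast
      then have "(x, y) \<in> \<Gamma> (g, h)" using xy by (auto simp: \<Gamma>_def)
      then show False using xy4 gh by blast
    qed
    then show "(x, y) \<in> ?disjoint" using xy by blast
  qed
  with negligible_pairs_Un[OF negligible_pairs_disjoint[OF Y S dim] graphs] show ?thesis
    by (rule negligible_pairs_subset)
qed

text \<open>\<open>S\<close> is a minimal set such that the edges \<open>{g x, g y}\<close> with \<open>g \<in> S\<close> cover \<open>P\<close>;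
  by minimality each edge has an end that no other edge covers.\<close>

lemma ex_private_vertices:
  assumes xy: "x \<in> X" "y \<in> X" "x \<noteq> y" and P: "finite P" "P \<subseteq> orbit G \<phi> x"
  obtains S \<sigma> where "finite S" "S \<subseteq> carrier G" "card P \<le> 2 * card S" "private_vertices S \<sigma> x y"
proof -
  define cov where "cov S = (\<lambda>g. \<phi> g x) ` S \<union> (\<lambda>g. \<phi> g y) ` S" for S
  define good where "good n \<longleftrightarrow> (\<exists>S. finite S \<and> S \<subseteq> carrier G \<and> P \<subseteq> cov S \<and> card S = n)" for n
  have "P \<subseteq> (\<lambda>g. \<phi> g x) ` carrier G" using P(2) by (auto simp: orbit_def)
  then obtain S0 where "S0 \<subseteq> carrier G" "finite S0" "P = (\<lambda>g. \<phi> g x) ` S0"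
    using P(1) finite_subset_image by metis
  then have "good (card S0)" unfolding good_def cov_def by blast
  then have "good (LEAST n. good n)" by (rule LeastI)
  then obtain S where S: "finite S" "S \<subseteq> carrier G" "P \<subseteq> cov S" "card S = (LEAST n. good n)"
    unfolding good_def by blast
  have "\<exists>p. p \<in> P \<and> p \<notin> cov (S - {g})" if g: "g \<in> S" for g
  proof (rule ccontr)
    assume "\<nexists>p. p \<in> P \<and> p \<notin> cov (S - {g})"
    then have "P \<subseteq> cov (S - {g})" by blast
    then have "good (card (S - {g}))" unfolding good_def using S(1,2) by blast
    then have "card S \<le> card (S - {g})" using S(4) Least_le by metis
    then show False using g S(1) card_Diff1_less by (metis not_le)
  qed
  then obtain p where p: "\<And>g. g \<in> S \<Longrightarrow> p g \<in> P \<and> p g \<notin> cov (S - {g})" by metis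
  define \<sigma> where "\<sigma> g \<longleftrightarrow> p g = \<phi> g x" for g
  have p_eq: "p g = vert x y (\<sigma> g, g)" if "g \<in> S" for g
  proof -
    have "p g \<in> cov S" using p[OF that] S(3) by blast
    then have "p g = \<phi> g x \<or> p g = \<phi> g y" using p[OF that] by (auto simp: cov_def)
    then show ?thesis by (auto simp: vert_def \<sigma>_def)
  qed
  have "private_vertices S \<sigma> x y"
    unfolding private_vertices_def
  proof (intro ballI impI)
    fix g w assume gw: "g \<in> S" "w \<in> UNIV \<times> S" "w \<noteq> (\<sigma> g, g)"
    obtain t h where w: "w = (t, h)" "h \<in> S" using gw(2) by auto
    show "vert x y (\<sigma> g, g) \<noteq> vert x y w"
    proof (cases "h = g")
      case True
      \<comment> \<open>Minimality says nothing about the two ends of one edge; these differ because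
        \<open>x \<noteq> y\<close>.\<close>
      have "\<phi> g x \<noteq> \<phi> g y" using act_inj xy gw(1) S(2) by blast
      then show ?thesis using True w gw(3) by (auto simp: vert_def)
    next
      case False
      then have "vert x y w \<in> cov (S - {g})" using w by (auto simp: cov_def vert_def)
      then show ?thesis using p[OF gw(1)] p_eq[OF gw(1)] by metis
    qed
  qed
  moreover have "card P \<le> 2 * card S"
  proof -
    have "card P \<le> card (cov S)" using S by (intro card_mono) (auto simp: cov_def)
    also have "\<dots> \<le> card ((\<lambda>g. \<phi> g x) ` S) + card ((\<lambda>g. \<phi> g y) ` S)"
      unfolding cov_def by (rule card_Un_le)
    also have "\<dots> \<le> card S + card S" using S(1) card_image_le by (intro add_mono) auto
    finally show ?thesis by simp
  qed
  ultimately show ?thesis using that S by blast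
qed

text \<open>Finitely many inequalities between vertices form an open condition.\<close>

lemma private_vertices_neighbourhood:
  assumes "x0 \<in> X" "y0 \<in> X" "finite S" "S \<subseteq> carrier G" "private_vertices S \<sigma> x0 y0"
  obtains \<delta> where "\<delta> > 0"
    "\<forall>x\<in>mcball x0 \<delta>. \<forall>y\<in>mcball y0 \<delta>. private_vertices S \<sigma> x y"
proof -
  have P: "finite ((UNIV :: bool set) \<times> S)" "snd ` ((UNIV :: bool set) \<times> S) \<subseteq> carrier G"
    using assms by auto
  obtain \<delta> where \<delta>: "\<delta> > 0" "\<forall>v\<in>UNIV \<times> S. \<forall>w\<in>UNIV \<times> S. vert x0 y0 v \<noteq> vert x0 y0 w \<longrightarrow>
    (\<forall>x\<in>mcball x0 \<delta>. \<forall>y\<in>mcball y0 \<delta>. \<forall>x'\<in>mcball x0 \<delta>. \<forall>y'\<in>mcball y0 \<delta>. vert x y v \<noteq> vert x' y' w)"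
    using separated_neighbourhoods[OF assms(1,2) P] by (elim exE conjE)
  show ?thesis
  proof (rule that[OF \<delta>(1)], intro ballI)
    fix x y assume "x \<in> mcball x0 \<delta>" "y \<in> mcball y0 \<delta>"
    then show "private_vertices S \<sigma> x y"
      using \<delta>(2) assms(5) unfolding private_vertices_def by (metis SigmaI UNIV_I)
  qed
qed

lemma injective_orbit_neighbourhood:
  assumes "x0 \<in> X" "finite H" "H \<subseteq> carrier G" "inj_on (\<lambda>h. \<phi> h x0) H"
  obtains \<delta> where "\<delta> > 0" "\<forall>x\<in>mcball x0 \<delta>. inj_on (\<lambda>h. \<phi> h x) H"
proof -
  have P: "finite ({True} \<times> H)" "snd ` ({True} \<times> H) \<subseteq> carrier G" using assms by auto
  obtain \<delta> where \<delta>: "\<delta> > 0" "\<forall>v\<in>{True} \<times> H. \<forall>w\<in>{True} \<times> H. vert x0 x0 v \<noteq> vert x0 x0 w \<longrightarrow>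
    (\<forall>x\<in>mcball x0 \<delta>. \<forall>y\<in>mcball x0 \<delta>. \<forall>x'\<in>mcball x0 \<delta>. \<forall>y'\<in>mcball x0 \<delta>. vert x y v \<noteq> vert x' y' w)"
    using separated_neighbourhoods[OF assms(1,1) P] by (elim exE conjE)
  show ?thesis
  proof (rule that[OF \<delta>(1)], intro ballI inj_onI, rule ccontr)
    fix x g h assume x: "x \<in> mcball x0 \<delta>" and gh: "g \<in> H" "h \<in> H" "\<phi> g x = \<phi> h x" "g \<noteq> h"
    have "vert x0 x0 (True, g) \<noteq> vert x0 x0 (True, h)"
      using assms(4) gh by (auto simp: vert_def dest: inj_onD)
    then have "vert x x (True, g) \<noteq> vert x x (True, h)" using \<delta>(2) x gh(1,2) by blast
    then show False using gh(3) by (simp add: vert_def)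
  qed
qed

lemma orbit_transversal:
  assumes "finite P" "P \<subseteq> orbit G \<phi> x"
  obtains H where "finite H" "H \<subseteq> carrier G" "inj_on (\<lambda>h. \<phi> h x) H" "(\<lambda>h. \<phi> h x) ` H = P"
proof -
  have "P \<subseteq> (\<lambda>h. \<phi> h x) ` carrier G" using assms(2) by (auto simp: orbit_def)
  then obtain H where "H \<subseteq> carrier G" "inj_on (\<lambda>h. \<phi> h x) H" "P = (\<lambda>h. \<phi> h x) ` H"
    by (meson subset_image_inj)
  then show ?thesis using that assms(1) finite_imageD by metis
qed

lemma image_subset_orbit: "H \<subseteq> carrier G \<Longrightarrow> (\<lambda>h. \<phi> h x) ` H \<subseteq> orbit G \<phi> x"
  by (auto simp: orbit_def)

section \<open>Pairs sorted by orbit size\<close>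

text \<open>Orbit size is lower semicontinuous: \<open>N + 1\<close> group elements that move
  \<open>x0\<close> to distinct points do the same to all nearby points.\<close>

lemma closedin_points_of_orbit_card_le:
  "closedin mtopology (points_of_orbit_card_le G X \<phi> N)"
proof -
  let ?Y = "points_of_orbit_card_le G X \<phi> N"
  have "\<exists>r>0. mball x0 r \<subseteq> X - ?Y" if x0: "x0 \<in> X - ?Y" for x0
  proof -
    obtain P where P: "finite P" "P \<subseteq> orbit G \<phi> x0" "card P = Suc N"
    proof (cases "finite (orbit G \<phi> x0)")
      case True
      then have "Suc N \<le> card (orbit G \<phi> x0)" using x0 by (auto simp: points_of_orbit_card_le_def)
      then show ?thesis using that obtain_subset_with_card_n by metis
    next
      case False
      then show ?thesis using that infinite_arbitrarily_large by metis
    qed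
    obtain H where H: "finite H" "H \<subseteq> carrier G" "inj_on (\<lambda>h. \<phi> h x0) H" "(\<lambda>h. \<phi> h x0) ` H = P"
      using orbit_transversal[OF P(1,2)] by blast
    have "card H = Suc N" using H P(3) card_image by metis
    have "x0 \<in> X" using x0 by blast
    from injective_orbit_neighbourhood[OF this H(1-3)] obtain \<delta>
      where \<delta>: "\<delta> > 0" "\<forall>x\<in>mcball x0 \<delta>. inj_on (\<lambda>h. \<phi> h x) H" by blast
    have "mball x0 \<delta> \<subseteq> X - ?Y"
    proof
      fix x assume x: "x \<in> mball x0 \<delta>"
      then have "inj_on (\<lambda>h. \<phi> h x) H" using \<delta>(2) mball_subset_mcball by blast
      then have card: "card ((\<lambda>h. \<phi> h x) ` H) = Suc N" using card_image \<open>card H = Suc N\<close> by metis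
      have "\<not> card (orbit G \<phi> x) \<le> N" if "finite (orbit G \<phi> x)"
        using card_mono[OF that image_subset_orbit[OF H(2)]] card by simp
      then show "x \<in> X - ?Y" using x by (auto simp: points_of_orbit_card_le_def)
    qed
    then show ?thesis using \<delta>(1) by blast
  qed
  then have "openin mtopology (X - ?Y)" unfolding openin_mtopology by blast
  moreover have "?Y \<subseteq> X" by (auto simp: points_of_orbit_card_le_def)
  ultimately show ?thesis by (simp add: closedin_def)
qed

text \<open>An infinite orbit provides arbitrarily many edges, so any finite bound on the dimension
  of all of \<open>X\<close> is beaten.\<close>

lemma negligible_pairs_infinite_orbit:
  assumes "covering_order_le mtopology m"
  shows "negligible_pairs TYPE('r::finite) {(x, y) \<in> X \<times> X. x \<noteq> y \<and> infinite (orbit G \<phi> x)}"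
proof (rule negligible_pairs_locally)
  fix x0 y0 assume "(x0, y0) \<in> {(x, y) \<in> X \<times> X. x \<noteq> y \<and> infinite (orbit G \<phi> x)}"
  then have xy: "x0 \<in> X" "y0 \<in> X" "x0 \<noteq> y0" and inf: "infinite (orbit G \<phi> x0)" by auto
  \<comment> \<open>With \<open>4 * m + 1\<close> points to cover, \<open>S\<close> has at least
    \<open>2 * m + 1\<close> edges, enough even for \<open>r = 1\<close>.\<close>
  obtain P where P: "finite P" "P \<subseteq> orbit G \<phi> x0" "card P = 4 * m + 1"
    using infinite_arbitrarily_large[OF inf] by metis
  obtain S \<sigma> where S: "finite S" "S \<subseteq> carrier G" "card P \<le> 2 * card S" "private_vertices S \<sigma> x0 y0"
    using ex_private_vertices[OF xy P(1,2)] by blast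
  obtain \<delta> where \<delta>: "\<delta> > 0" "\<forall>x\<in>mcball x0 \<delta>. \<forall>y\<in>mcball y0 \<delta>. private_vertices S \<sigma> x y"
    using private_vertices_neighbourhood[OF xy(1,2) S(1,2,4)] by blast
  have "2 * (m - 1) < card S" using S(3) P(3) by simp
  also have "\<dots> \<le> CARD('r) * card S" by simp
  finally have "negligible_pairs TYPE('r) {(x, y) \<in> X \<times> X. private_vertices S \<sigma> x y}"
    using assms S(1,2) closedin_topspace[of mtopology]
    by (intro negligible_pairs_private[where m = m]) auto
  then have "negligible_pairs TYPE('r)
    ({(x, y) \<in> X \<times> X. x \<noteq> y \<and> infinite (orbit G \<phi> x)} \<inter> mball x0 \<delta> \<times> mball y0 \<delta>)"
    by (rule negligible_pairs_subset) (use \<delta>(2) mball_subset_mcball in blast)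
  then show "\<exists>U V. openin mtopology U \<and> openin mtopology V \<and> x0 \<in> U \<and> y0 \<in> V \<and>
      negligible_pairs TYPE('r) ({(x, y) \<in> X \<times> X. x \<noteq> y \<and> infinite (orbit G \<phi> x)} \<inter> U \<times> V)"
    using xy \<delta>(1) by (intro exI[of _ "mball x0 \<delta>"] exI[of _ "mball y0 \<delta>"]) auto
qed auto

text \<open>Partners outside the orbit of \<open>x\<close> (\<open>Q False\<close>) need
  \<open>2 * (m - 1)\<close> parameters but leave \<open>N\<close> edges; partners inside it
  (\<open>Q True\<close>) need \<open>m - 1\<close> and leave at least half as many edges. Both
  balances reduce to the same inequality.\<close>

lemma negligible_pairs_finite_orbit:
  fixes N :: nat
  defines "Y \<equiv> points_of_orbit_card_le G X \<phi> N"
  assumes m: "covering_order_le (subtopology mtopology Y) m" "2 * (m - 1) < CARD('r::finite) * N"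
  shows "negligible_pairs TYPE('r) {(x, y) \<in> Y \<times> Y. x \<noteq> y \<and> card (orbit G \<phi> x) = N}"
proof -
  have closed: "closedin mtopology Y" unfolding Y_def by (rule closedin_points_of_orbit_card_le)
  have Y: "x \<in> X \<and> finite (orbit G \<phi> x)" if "x \<in> Y" for x
    using that by (simp add: Y_def points_of_orbit_card_le_def)
  define Q where "Q b = {(x, y) \<in> Y \<times> Y. x \<noteq> y \<and> card (orbit G \<phi> x) = N \<and> (y \<in> orbit G \<phi> x \<longleftrightarrow> b)}" for b
  have "negligible_pairs TYPE('r) (Q False)"
  proof (rule negligible_pairs_locally)
    show "Q False \<subseteq> X \<times> X" using Y by (auto simp: Q_def)
    fix x0 y0 assume xy0: "(x0, y0) \<in> Q False"
    then have x0: "x0 \<in> X" "finite (orbit G \<phi> x0)" "card (orbit G \<phi> x0) = N"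
      and y0: "y0 \<in> X" "y0 \<notin> orbit G \<phi> x0"
      using Y by (auto simp: Q_def)
    obtain S where S: "finite S" "S \<subseteq> carrier G" "inj_on (\<lambda>h. \<phi> h x0) S" "(\<lambda>h. \<phi> h x0) ` S = orbit G \<phi> x0"
      using orbit_transversal[OF x0(2) order_refl] by blast
    have card: "card S = N" using card_image[OF S(3)] S(4) x0(3) by simp
    have "\<phi> g x0 \<noteq> \<phi> h y0" if gh: "g \<in> S" "h \<in> S" for g h
    proof
      assume eq: "\<phi> g x0 = \<phi> h y0"
      have "y0 = \<phi> (inv h \<otimes> g) x0" using act_eq_imp[OF _ _ _ _ eq] gh S(2) x0(1) y0(1) by blast
      then show False using y0(2) gh S(2) by (auto simp: orbit_def)
    qed
    \<comment> \<open>The points \<open>g x0\<close> with \<open>g\<close> in the transversal are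
      distinct and avoid the orbit of \<open>y0\<close>, so all ends on the side of
      \<open>x0\<close> are private.\<close>
    then have "private_vertices S (\<lambda>_. True) x0 y0"
      using S(3) unfolding private_vertices_def by (auto simp: vert_def dest: inj_onD)
    from private_vertices_neighbourhood[OF x0(1) y0(1) S(1,2) this] obtain \<delta>
      where \<delta>: "\<delta> > 0" "\<forall>x\<in>mcball x0 \<delta>. \<forall>y\<in>mcball y0 \<delta>. private_vertices S (\<lambda>_. True) x y" by blast
    have "negligible_pairs TYPE('r) {(x, y) \<in> Y \<times> Y. private_vertices S (\<lambda>_. True) x y}"
      using m(2) card by (intro negligible_pairs_private[OF closed m(1) S(1,2)]) simp
    then have "negligible_pairs TYPE('r) (Q False \<inter> mball x0 \<delta> \<times> mball y0 \<delta>)"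
      by (rule negligible_pairs_subset) (use \<delta>(2) mball_subset_mcball in \<open>unfold Q_def, blast\<close>)
    then show "\<exists>U V. openin mtopology U \<and> openin mtopology V \<and> x0 \<in> U \<and> y0 \<in> V \<and>
        negligible_pairs TYPE('r) (Q False \<inter> U \<times> V)"
      using x0(1) y0(1) \<delta>(1) by (intro exI[of _ "mball x0 \<delta>"] exI[of _ "mball y0 \<delta>"]) auto
  qed
  moreover have "negligible_pairs TYPE('r) (Q True)"
  proof (rule negligible_pairs_locally)
    show "Q True \<subseteq> X \<times> X" using Y by (auto simp: Q_def)
    fix x0 y0 assume xy0: "(x0, y0) \<in> Q True"
    then have x0: "x0 \<in> X" "finite (orbit G \<phi> x0)" "card (orbit G \<phi> x0) = N"
      and y0: "y0 \<in> X" "x0 \<noteq> y0"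
      using Y by (auto simp: Q_def)
    obtain S \<sigma> where S: "finite S" "S \<subseteq> carrier G" "N \<le> 2 * card S" "private_vertices S \<sigma> x0 y0"
      using ex_private_vertices[OF x0(1) y0 x0(2) order_refl] x0(3) by metis
    obtain \<delta> where \<delta>: "\<delta> > 0" "\<forall>x\<in>mcball x0 \<delta>. \<forall>y\<in>mcball y0 \<delta>. private_vertices S \<sigma> x y"
      using private_vertices_neighbourhood[OF x0(1) y0(1) S(1,2,4)] by blast
    \<comment> \<open>For nearby \<open>x\<close> with exactly \<open>N\<close> orbit points,
      \<open>H\<close> still reaches the whole orbit. So the pairs in question lie on the finitely
      many graphs of elements of \<open>H\<close>.\<close>
    obtain H where H: "finite H" "H \<subseteq> carrier G" "inj_on (\<lambda>h. \<phi> h x0) H" "(\<lambda>h. \<phi> h x0) ` H = orbit G \<phi> x0"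
      using orbit_transversal[OF x0(2) order_refl] by blast
    have card: "card H = N" using card_image[OF H(3)] H(4) x0(3) by simp
    obtain \<delta>' where \<delta>': "\<delta>' > 0" "\<forall>x\<in>mcball x0 \<delta>'. inj_on (\<lambda>h. \<phi> h x) H"
      using injective_orbit_neighbourhood[OF x0(1) H(1-3)] by blast
    define \<Gamma> where "\<Gamma> h = (\<lambda>x. (x, \<phi> h x)) ` {x \<in> Y. private_vertices S \<sigma> x (\<phi> h x)}" for h
    have "2 * (m - 1) < CARD('r) * (2 * card S)"
      using m(2) mult_le_mono2[OF S(3), of "CARD('r)"] by linarith
    then have dim: "m - 1 < CARD('r) * card S" by simp
    have "negligible_pairs TYPE('r) (\<Union>h\<in>H. \<Gamma> h)"
      unfolding \<Gamma>_def using H(1,2)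
      by (intro negligible_pairs_UN negligible_pairs_graph[OF closed m(1) S(1,2) _ dim])
        (auto simp: countable_finite)
    moreover have "Q True \<inter> mball x0 (min \<delta> \<delta>') \<times> mball y0 \<delta> \<subseteq> (\<Union>h\<in>H. \<Gamma> h)"
    proof clarify
      fix x y assume xy: "(x, y) \<in> Q True" "x \<in> mball x0 (min \<delta> \<delta>')" "y \<in> mball y0 \<delta>"
      then have x: "x \<in> Y" "card (orbit G \<phi> x) = N" "y \<in> orbit G \<phi> x" by (auto simp: Q_def)
      have near: "x \<in> mcball x0 \<delta>" "x \<in> mcball x0 \<delta>'" "y \<in> mcball y0 \<delta>" using xy by auto
      then have "card ((\<lambda>h. \<phi> h x) ` H) = N" using \<delta>'(2) card_image card by metis
      then have "(\<lambda>h. \<phi> h x) ` H = orbit G \<phi> x"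
        using Y[OF x(1)] x(2) by (intro card_subset_eq image_subset_orbit[OF H(2)]) auto
      then obtain h where "h \<in> H" "y = \<phi> h x" using x(3) by blast
      moreover have "private_vertices S \<sigma> x y" using \<delta>(2) near by blast
      ultimately show "(x, y) \<in> (\<Union>h\<in>H. \<Gamma> h)" using x(1) by (auto simp: \<Gamma>_def)
    qed
    ultimately have "negligible_pairs TYPE('r) (Q True \<inter> mball x0 (min \<delta> \<delta>') \<times> mball y0 \<delta>)"
      by (rule negligible_pairs_subset)
    then show "\<exists>U V. openin mtopology U \<and> openin mtopology V \<and> x0 \<in> U \<and> y0 \<in> V \<and>
        negligible_pairs TYPE('r) (Q True \<inter> U \<times> V)"
      using x0(1) y0(1) \<delta>(1) \<delta>'(1)
      by (intro exI[of _ "mball x0 (min \<delta> \<delta>')"] exI[of _ "mball y0 \<delta>"]) auto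
  qed
  ultimately have "negligible_pairs TYPE('r) (Q False \<union> Q True)" by (rule negligible_pairs_Un)
  then show ?thesis by (rule negligible_pairs_subset) (auto simp: Q_def)
qed

text \<open>Up to exchanging \<open>x\<close> and \<open>y\<close>, the orbit of \<open>x\<close> is
  infinite, or it has some finite size \<open>N\<close> and that of \<open>y\<close> is no larger.
  The exchange is harmless since separation is symmetric.\<close>

lemma negligible_pairs_off_diagonal:
  assumes "covering_dim mtopology < \<infinity>"
    and dims: "\<And>N::nat. N \<ge> 1 \<Longrightarrow>
      covering_dim (subtopology mtopology (points_of_orbit_card_le G X \<phi> N))
        < ereal (real CARD('r::finite) * real N / 2)"
  shows "negligible_pairs TYPE('r) {(x, y) \<in> X \<times> X. x \<noteq> y}"
proof -
  let ?Y = "\<lambda>N. points_of_orbit_card_le G X \<phi> N"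
  define R where "R N = {(x, y) \<in> ?Y N \<times> ?Y N. x \<noteq> y \<and> card (orbit G \<phi> x) = N}" for N
  define R' where "R' = {(x, y) \<in> X \<times> X. x \<noteq> y \<and> infinite (orbit G \<phi> x)} \<union> (\<Union>N\<in>{1..}. R N)"
  obtain m where "covering_order_le mtopology m"
    using covering_order_of_covering_dim_less[OF assms(1)] by metis
  then have "negligible_pairs TYPE('r) {(x, y) \<in> X \<times> X. x \<noteq> y \<and> infinite (orbit G \<phi> x)}"
    by (rule negligible_pairs_infinite_orbit)
  moreover have "negligible_pairs TYPE('r) (R N)" if N: "N \<ge> 1" for N
  proof -
    obtain m where m: "covering_order_le (subtopology mtopology (?Y N)) m"
      "ereal (real m - 1) < ereal (real CARD('r) * real N / 2)"
      using covering_order_of_covering_dim_less[OF dims[OF N]] by metis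
    \<comment> \<open>For \<open>m = 0\<close> the truncated \<open>m - 1\<close> is 0 and not -1;
      the inequality then rests on \<open>N \<ge> 1\<close>.\<close>
    have "real (2 * (m - 1)) < real (CARD('r) * N)"
      using m(2) N by (cases m) (auto simp: field_simps)
    then have "2 * (m - 1) < CARD('r) * N" by (simp only: of_nat_less_iff)
    then show ?thesis unfolding R_def using m(1) by (intro negligible_pairs_finite_orbit)
  qed
  then have "negligible_pairs TYPE('r) (\<Union>N\<in>{1..}. R N)"
    by (intro negligible_pairs_UN) auto
  ultimately have "negligible_pairs TYPE('r) R'" unfolding R'_def by (rule negligible_pairs_Un)
  then have "negligible_pairs TYPE('r) (R' \<union> R'\<inverse>)"
    by (intro negligible_pairs_Un) (simp_all only: negligible_pairs_converse)
  moreover have "{(x, y) \<in> X \<times> X. x \<noteq> y} \<subseteq> R' \<union> R'\<inverse>"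
  proof (rule subrelI)
    fix x y assume "(x, y) \<in> {(x, y) \<in> X \<times> X. x \<noteq> y}"
    then have xy: "x \<in> X" "y \<in> X" "x \<noteq> y" by auto
    have covered: "(u, v) \<in> R'" if "u \<in> X" "v \<in> X" "u \<noteq> v" "finite (orbit G \<phi> u)" "finite (orbit G \<phi> v)"
      "card (orbit G \<phi> v) \<le> card (orbit G \<phi> u)" for u v
    proof -
      have "card (orbit G \<phi> u) \<ge> 1" using orbit_refl that by (auto simp: Suc_le_eq card_gt_0_iff)
      then show ?thesis using that by (auto simp: R'_def R_def points_of_orbit_card_le_def)
    qed
    show "(x, y) \<in> R' \<union> R'\<inverse>"
    proof (cases "finite (orbit G \<phi> x) \<and> finite (orbit G \<phi> y)")
      case True
      then show ?thesis using covered[of x y] covered[of y x] xy by (cases "card (orbit G \<phi> y) \<le> card (orbit G \<phi> x)") auto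
    next
      case False
      then show ?thesis using xy by (auto simp: R'_def)
    qed
  qed
  ultimately show ?thesis by (rule negligible_pairs_subset)
qed

section \<open>From separated points to equivariant embeddings\<close>

text \<open>The shift multiplies indices on the right, which matches the left action:
  \<open>f ((h \<otimes> g) x) = f (h (g x))\<close>.\<close>

lemma orbit_map_equivariant:
  assumes "f \<in> X \<rightarrow> unit_cube"
  shows "equivariant_map G X \<phi> (cube_shift G) (orbit_map G \<phi> f)"
  unfolding equivariant_map_def
proof (intro ballI)
  fix g x assume g: "g \<in> carrier G" and x: "x \<in> X"
  have "orbit_map G \<phi> f x \<in> topspace (cube_shift_space G)"
    using assms x by (auto simp: orbit_map_def cube_shift_space_def)
  then have "cube_shift G g (orbit_map G \<phi> f x) = (\<lambda>h\<in>carrier G. orbit_map G \<phi> f x (h \<otimes> g))"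
    by (simp add: cube_shift_def)
  also have "\<dots> = orbit_map G \<phi> f (\<phi> g x)"
    using g x by (auto simp: orbit_map_def composition_rule intro!: restrict_ext)
  finally show "orbit_map G \<phi> f (\<phi> g x) = cube_shift G g (orbit_map G \<phi> f x)" by simp
qed

text \<open>A continuous injection of a compact space into a Hausdorff space is an embedding, so
  only injectivity depends on \<open>f\<close>, and \<open>sep\<close> gives it.\<close>

lemma orbit_map_embedding:
  assumes f: "f \<in> X \<rightarrow> unit_cube" "continuous_map mtopology euclidean f"
    and sep: "\<And>x y. x \<in> X \<Longrightarrow> y \<in> X \<Longrightarrow> x \<noteq> y \<Longrightarrow> \<exists>g\<in>carrier G. f (\<phi> g x) \<noteq> f (\<phi> g y)"
  shows "embedding_map mtopology (cube_shift_space G) (orbit_map G \<phi> f)"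
proof (rule continuous_imp_embedding_map)
  show "continuous_map mtopology (cube_shift_space G) (orbit_map G \<phi> f)"
    unfolding cube_shift_space_def continuous_map_componentwise
  proof (intro conjI ballI)
    show "orbit_map G \<phi> f ` topspace mtopology \<subseteq> extensional (carrier G)"
      by (auto simp: orbit_map_def)
    fix g assume g: "g \<in> carrier G"
    have "continuous_map mtopology euclidean (\<lambda>x. f (\<phi> g x))"
      using continuous_map_compose[OF act_continuous[OF g] f(2)] by (simp add: o_def)
    then show "continuous_map mtopology (top_of_set unit_cube) (\<lambda>x. orbit_map G \<phi> f x g)"
      using g f(1) by (auto simp: orbit_map_def continuous_map_in_subtopology)
  qed
  show "compact_space mtopology" by (rule compact)
  show "Hausdorff_space (cube_shift_space G)"
    unfolding cube_shift_space_def
    by (auto simp: Hausdorff_space_product_topology intro: Hausdorff_space_subtopology)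
  show "inj_on (orbit_map G \<phi> f) (topspace mtopology)"
  proof (rule inj_onI, rule ccontr)
    fix x y assume xy: "x \<in> topspace mtopology" "y \<in> topspace mtopology"
      "orbit_map G \<phi> f x = orbit_map G \<phi> f y" "x \<noteq> y"
    then obtain g where g: "g \<in> carrier G" "f (\<phi> g x) \<noteq> f (\<phi> g y)" using sep by auto
    have "orbit_map G \<phi> f x g = orbit_map G \<phi> f y g" using xy(3) by simp
    then show False using g by (simp add: orbit_map_def)
  qed
qed

end

theorem theorem1p1:
  fixes G :: "('g, 'm) monoid_scheme"
    and X :: "'x set"
    and \<phi> :: "'g \<Rightarrow> 'x \<Rightarrow> 'x"
    and d :: "'x \<Rightarrow> 'x \<Rightarrow> real"
  assumes "topological_dynamical_system G X \<phi> d"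
    and "covering_dim (Metric_space.mtopology X d) < \<infinity>"
    and "\<And>N::nat. N \<ge> 1 \<Longrightarrow>
      covering_dim (subtopology (Metric_space.mtopology X d) (points_of_orbit_card_le G X \<phi> N))
        < ereal (real CARD('r::finite) * real N / 2)"
  shows "comeagre_in (mtopology_of (cube_maps (Metric_space.mtopology X d)))
    {f \<in> mspace (cube_maps (Metric_space.mtopology X d) :: ('x \<Rightarrow> real ^ 'r) metric).
       embedding_map (Metric_space.mtopology X d) (cube_shift_space G) (orbit_map G \<phi> f) \<and>
       equivariant_map G X \<phi> (cube_shift G) (orbit_map G \<phi> f)}"
proof -
  interpret topological_dynamical_system G X \<phi> d by fact
  let ?good = "{f \<in> mspace (cube_maps mtopology :: ('x \<Rightarrow> real ^ 'r) metric).
    embedding_map mtopology (cube_shift_space G) (orbit_map G \<phi> f) \<and>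
    equivariant_map G X \<phi> (cube_shift G) (orbit_map G \<phi> f)}"
  \<comment> \<open>Equivariance holds for every \<open>f\<close>, so a map outside the good set
    fails to embed and hence identifies two distinct points along their orbits.\<close>
  have "mspace (cube_maps mtopology) - ?good \<subseteq> unseparated {(x, y) \<in> X \<times> X. x \<noteq> y}"
  proof
    fix f :: "'x \<Rightarrow> real ^ 'r" assume f: "f \<in> mspace (cube_maps mtopology) - ?good"
    then have f_cube: "f \<in> X \<rightarrow> unit_cube" and cont: "continuous_map mtopology euclidean f"
      by (auto simp: mspace_cube_maps)
    have "\<not> embedding_map mtopology (cube_shift_space G) (orbit_map G \<phi> f)"
      using f orbit_map_equivariant[OF f_cube] by blast
    then have "\<exists>x\<in>X. \<exists>y\<in>X. x \<noteq> y \<and> (\<forall>g\<in>carrier G. f (\<phi> g x) = f (\<phi> g y))"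
      using orbit_map_embedding[OF f_cube cont] by blast
    then show "f \<in> unseparated {(x, y) \<in> X \<times> X. x \<noteq> y}"
      using f unfolding unseparated_def by blast
  qed
  with negligible_pairs_off_diagonal[OF assms(2,3)]
  have "meagre_in (mtopology_of (cube_maps mtopology)) (mspace (cube_maps mtopology) - ?good)"
    by (rule meagre_in_subset)
  then show ?thesis by (auto simp: comeagre_in_def)
qed

end
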